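(* Let $x_k$ be generated by the model-based iteration $$x_{k+1}=\operatorname*{argmin}_{y\in X}\Big\{f_{x_k}(y;S_k)+\varphi(y)+\frac{1}{2\alpha_k}\|y-x_k\|^2\Big\},\qquad S_k\stackrel{\text{i.i.d.}}{\sim}P,$$ started from $x_0\in X$, where the models $f_x(\cdot;s)$ satisfy conditions (C.i)--(C.iv) and the stepsizes $\alpha_k>0$ satisfy $\sum_k\alpha_k=\infty$ and $\sum_k\alpha_k^2<\infty$. Assume (L), (W), that $(F(X^\star))^c$ is dense in $\mathbb R$, that with probability 1 the iterates are bounded, $\sup_k\|x_k\|<\infty$, and that the function equal to $F$ on $X$ and $+\infty$ off $X$ is coercive (tends to $+\infty$ as $\|x\|\to\infty$). Then with probability 1, all cluster points of the sequence $\{x_k\}$ belong to the stationary set $X^\star$, and $F(x_k)=f(x_k)+\varphi(x_k)$ converges.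
   Context: Setting. $P$ is a probability distribution on a sample space $\mathcal S$, and $S\sim P$. $X\subset\mathbb R^d$ is a nonempty closed convex set and $\varphi:\mathbb R^d\to\mathbb R$ is a closed convex function. For each $s\in\mathcal S$, $f(\cdot;s):\mathbb R^d\to\mathbb R$; $f(x)=\mathbb E_P[f(x;S)]$ is finite for every $x\in\mathbb R^d$, and $F(x)=f(x)+\varphi(x)$. All functions of $s$ involved are measurable. $\|\cdot\|$ is the Euclidean norm and $\mathbb B$ the unit ball. For a function $h:\mathbb R^d\to\mathbb R\cup\{+\infty\}$, $\partial h(x)=\{g: h(y)\ge h(x)+\langle g,y-x\rangle+o(\|y-x\|)\text{ as }y\to x\}$ is the Fréchet subdifferential (the usual subdifferential for convex $h$). (L) With $M_\epsilon(x;s)=\sup_{y\in X,\|y-x\|\le\epsilon}\ \sup_{g\in\partial f(y;s)}\|g\|$, there is $\epsilon_0>0$ such that $0<\epsilon\le\epsilon_0$ implies $\mathbb E[M_\epsilon(x;S)^2]<\infty$ for all $x\in X$. (W) There is $\epsilon_0>0$ such that $0<\epsilon\le\epsilon_0$ implies that for all $x\in X$ there is $\lambda(s,x)\ge0$ such that $y\mapsto f(y;s)+\frac{\lambda(s,x)}2\|y-x_0\|^2$ is convex on $x+\epsilon\mathbb B$ for any $x_0\in\mathbb R^d$, and $\mathbb E[\lambda(S,x)]<\infty$. Models. For each $x\in X$ and $s\in\mathcal S$ one has a model $f_x(\cdot;s):\mathbb R^d\to\mathbb R\cup\{+\infty\}$ of $f(\cdot;s)$ at $x$; the argmin in the iteration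 is assumed attained (it is then unique) and measurable in $s$. Conditions: (C.i) $y\mapsto f_x(y;s)$ is convex and subdifferentiable on its domain. (C.ii) $f_x(x;s)=f(x;s)$. (C.iii) $\partial_y f_x(y;s)|_{y=x}\subset\partial f(x;s)$. (C.iv) There is $\epsilon_0>0$ such that $0<\epsilon\le\epsilon_0$ implies that for all $x_0\in X$ there is $\delta_\epsilon(x_0;s)\ge0$ with $f(y;s)\ge f_x(y;s)-\frac12\delta_\epsilon(x_0;s)\|y-x\|^2$ for all $x\in X\cap(x_0+\epsilon\mathbb B)$, $y\in x_0+\epsilon\mathbb B$, where $\mathbb E[\delta_\epsilon(x_0;S)]<\infty$. Stationary set: $X^\star=\{x\in X:\exists\, g\in\partial f(x)+\partial\varphi(x)\text{ with }\langle g,y-x\rangle\ge0\text{ for all }y\in X\}$, and $F(X^\star)=\{F(x):x\in X^\star\}$. *)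

theory Defs
  imports "HOL-Probability.Probability" "HOL-Library.Landau_Symbols"
begin

text \<open>
  Frechet subdifferential of an extended-real-valued function, with the usual convention that it
  is empty outside the effective domain. A real-valued function is passed as
  \<open>\<lambda>y. ereal (h y)\<close>.
\<close>
definition frechet_subdiff :: "('a::euclidean_space \<Rightarrow> ereal) \<Rightarrow> 'a \<Rightarrow> 'a set" where
  "frechet_subdiff h x = {g. \<bar>h x\<bar> \<noteq> \<infinity> \<and>
     (\<exists>r \<in> o[at x](\<lambda>y. norm (y - x)).
        \<forall>\<^sub>F y in at x. h y \<ge> h x + ereal (g \<bullet> (y - x) + r y))}"

definition ereal_convex :: "('a::real_vector \<Rightarrow> ereal) \<Rightarrow> bool" where
  "ereal_convex h \<longleftrightarrow> convex {(y, t::real). h y \<le> ereal t}"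

definition closed_convex_fun :: "('a::euclidean_space \<Rightarrow> real) \<Rightarrow> bool" where
  "closed_convex_fun h \<longleftrightarrow> convex_on UNIV h \<and> closed (epigraph UNIV h)"

text \<open>
  Throughout, \<open>f y s\<close> is the sample loss \<open>f(y;s)\<close> and \<open>fm x y s\<close> is the
  model \<open>f\<^sub>x(y;s)\<close> centred at \<open>x\<close>. The local constant takes values in
  \<open>[0,\<infinity>]\<close>.
\<close>
definition local_lip :: "'a::euclidean_space set \<Rightarrow> ('a \<Rightarrow> 's \<Rightarrow> real) \<Rightarrow> real \<Rightarrow> 'a \<Rightarrow> 's \<Rightarrow> ennreal" where
  "local_lip X f \<epsilon> x s =
     (SUP y \<in> X \<inter> cball x \<epsilon>. SUP g \<in> frechet_subdiff (\<lambda>z. ereal (f z s)) y. ennreal (norm g))"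

text \<open>
  Measurability of the local constant is part of the condition, since
  \<open>nn_integral\<close> is only a lower integral for non-measurable functions.
\<close>
definition cond_L :: "'s measure \<Rightarrow> 'a::euclidean_space set \<Rightarrow> ('a \<Rightarrow> 's \<Rightarrow> real) \<Rightarrow> bool" where
  "cond_L P X f \<longleftrightarrow> (\<exists>\<epsilon>0>0. \<forall>\<epsilon>. 0 < \<epsilon> \<and> \<epsilon> \<le> \<epsilon>0 \<longrightarrow> (\<forall>x\<in>X.
     local_lip X f \<epsilon> x \<in> borel_measurable P \<and>
     (\<integral>\<^sup>+s. (local_lip X f \<epsilon> x s)\<^sup>2 \<partial>P) < \<infinity>))"

definition cond_W :: "'s measure \<Rightarrow> 'a::euclidean_space set \<Rightarrow> ('a \<Rightarrow> 's \<Rightarrow> real) \<Rightarrow> bool" where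
  "cond_W P X f \<longleftrightarrow> (\<exists>\<epsilon>0>0. \<forall>\<epsilon>. 0 < \<epsilon> \<and> \<epsilon> \<le> \<epsilon>0 \<longrightarrow> (\<forall>x\<in>X.
     \<exists>l :: 's \<Rightarrow> real. integrable P l \<and> (\<forall>s\<in>space P. 0 \<le> l s \<and>
       (\<forall>x0. convex_on (cball x \<epsilon>) (\<lambda>y. f y s + l s / 2 * (norm (y - x0))\<^sup>2)))))"

definition cond_C1 :: "'s measure \<Rightarrow> 'a::euclidean_space set \<Rightarrow> ('a \<Rightarrow> 'a \<Rightarrow> 's \<Rightarrow> ereal) \<Rightarrow> bool" where
  "cond_C1 P X fm \<longleftrightarrow> (\<forall>x\<in>X. \<forall>s\<in>space P. ereal_convex (\<lambda>y. fm x y s) \<and>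
     (\<forall>y. fm x y s < \<infinity> \<longrightarrow> frechet_subdiff (\<lambda>y. fm x y s) y \<noteq> {}))"

definition cond_C2 :: "'s measure \<Rightarrow> 'a::euclidean_space set \<Rightarrow> ('a \<Rightarrow> 's \<Rightarrow> real) \<Rightarrow>
    ('a \<Rightarrow> 'a \<Rightarrow> 's \<Rightarrow> ereal) \<Rightarrow> bool" where
  "cond_C2 P X f fm \<longleftrightarrow> (\<forall>x\<in>X. \<forall>s\<in>space P. fm x x s = ereal (f x s))"

definition cond_C3 :: "'s measure \<Rightarrow> 'a::euclidean_space set \<Rightarrow> ('a \<Rightarrow> 's \<Rightarrow> real) \<Rightarrow>
    ('a \<Rightarrow> 'a \<Rightarrow> 's \<Rightarrow> ereal) \<Rightarrow> bool" where
  "cond_C3 P X f fm \<longleftrightarrow> (\<forall>x\<in>X. \<forall>s\<in>space P.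
     frechet_subdiff (\<lambda>y. fm x y s) x \<subseteq> frechet_subdiff (\<lambda>y. ereal (f y s)) x)"

definition cond_C4 :: "'s measure \<Rightarrow> 'a::euclidean_space set \<Rightarrow> ('a \<Rightarrow> 's \<Rightarrow> real) \<Rightarrow>
    ('a \<Rightarrow> 'a \<Rightarrow> 's \<Rightarrow> ereal) \<Rightarrow> bool" where
  "cond_C4 P X f fm \<longleftrightarrow> (\<exists>\<epsilon>0>0. \<forall>\<epsilon>. 0 < \<epsilon> \<and> \<epsilon> \<le> \<epsilon>0 \<longrightarrow> (\<forall>x0\<in>X.
     \<exists>\<delta> :: 's \<Rightarrow> real. integrable P \<delta> \<and> (\<forall>s\<in>space P. 0 \<le> \<delta> s \<and>
       (\<forall>x \<in> X \<inter> cball x0 \<epsilon>. \<forall>y \<in> cball x0 \<epsilon>.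
          ereal (f y s) \<ge> fm x y s - ereal (1/2 * \<delta> s * (norm (y - x))\<^sup>2)))))"

definition mean_loss :: "'s measure \<Rightarrow> ('a::euclidean_space \<Rightarrow> 's \<Rightarrow> real) \<Rightarrow> 'a \<Rightarrow> real" where
  "mean_loss P f x = (\<integral>s. f x s \<partial>P)"

definition objective :: "'s measure \<Rightarrow> ('a::euclidean_space \<Rightarrow> 's \<Rightarrow> real) \<Rightarrow> ('a \<Rightarrow> real) \<Rightarrow> 'a \<Rightarrow> real" where
  "objective P f \<phi> x = mean_loss P f x + \<phi> x"

definition stationary_set :: "'s measure \<Rightarrow> 'a::euclidean_space set \<Rightarrow> ('a \<Rightarrow> 's \<Rightarrow> real) \<Rightarrow>
    ('a \<Rightarrow> real) \<Rightarrow> 'a set" where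
  "stationary_set P X f \<phi> = {x\<in>X.
     \<exists>u \<in> frechet_subdiff (\<lambda>y. ereal (mean_loss P f y)) x.
     \<exists>v \<in> frechet_subdiff (\<lambda>y. ereal (\<phi> y)) x. \<forall>y\<in>X. (u + v) \<bullet> (y - x) \<ge> 0}"

text \<open>The function minimised over \<open>y \<in> X\<close> in one step from \<open>x\<close> with stepsize
  \<open>a\<close> and sample \<open>s\<close>.\<close>
definition step_objective :: "('a::euclidean_space \<Rightarrow> 'a \<Rightarrow> 's \<Rightarrow> ereal) \<Rightarrow> ('a \<Rightarrow> real) \<Rightarrow>
    real \<Rightarrow> 'a \<Rightarrow> 's \<Rightarrow> 'a \<Rightarrow> ereal" where
  "step_objective fm \<phi> a x s y = fm x y s + ereal (\<phi> y + 1 / (2 * a) * (norm (y - x))\<^sup>2)"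

text \<open>The sigma-algebra generated by \<open>S 0, \<dots>, S (k - 1)\<close>.\<close>
definition past :: "'w measure \<Rightarrow> 's measure \<Rightarrow> (nat \<Rightarrow> 'w \<Rightarrow> 's) \<Rightarrow> nat \<Rightarrow> 'w measure" where
  "past \<Omega> P S k = sigma (space \<Omega>) (\<Union>i<k. {S i -` A \<inter> space \<Omega> | A. A \<in> sets P})"

end

theory Submission
  imports Defs
begin

text \<open>
  The Moreau envelope of the objective \<open>F\<close> is a Lyapunov function of the method. Fix \<open>R\<close>, consider runs
  that stay in the ball of radius \<open>R\<close>, and let \<open>K\<close> and \<open>K'\<close> be the intersections of \<open>X\<close> with the balls
  of radius \<open>R\<close> and \<open>R + 1\<close>. Compactness makes all local constants of the assumptions uniform there
  (\<open>cond_L_uniform\<close>, \<open>cond_C4_uniform\<close>). For a small \<open>t\<close> let \<open>e x\<close> be the minimum over \<open>y\<close> in \<open>K'\<close> of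
  \<open>F y + (norm (y - x))\<^sup>2 / (2 * t)\<close>, and let \<open>G = F - e\<close>, which is nonnegative on \<open>K'\<close>. If \<open>G z = 0\<close>
  with \<open>z\<close> in \<open>K\<close>, then \<open>z\<close> minimizes \<open>F y + (norm (y - z))\<^sup>2 / (2 * t)\<close> over the points of \<open>X\<close>
  near \<open>z\<close>. As \<open>F\<close> is weakly convex near \<open>z\<close>, convex separation shows that \<open>z\<close> is stationary
  (\<open>envelope_fixed_point_stationary\<close>).

  One step of the method is a proximal step for a convex model. Comparing it with a near minimizer
  in the definition of \<open>e (x k)\<close> (\<open>model_step_bounds\<close>) and integrating over the fresh sample bounds the
  conditional mean of \<open>e (x (Suc k))\<close> by \<open>e (x k) - \<alpha> k / t * G (x k)\<close> plus a constant times
  \<open>(\<alpha> k)\<^sup>2\<close>. Summation of expectations gives \<open>\<Sum>k. \<alpha> k * G (x k) < \<infinity>\<close> almost surely. Because \<open>S k\<close> is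
  independent of \<open>x k\<close>, the series stays finite when its terms are multiplied by \<open>1 + q (S k)\<close>, where
  the integrable function \<open>q\<close> dominates the squared slopes of the sampled problem
  (\<open>expected_descent_imp_AE_summable\<close>). The step from \<open>x k\<close> has length at most
  \<open>2 * \<alpha> k * (1 + q (S k))\<close>, so that the same series also bounds the distance that the iterates travel
  while the gap is not small. With \<open>\<Sum>k. \<alpha> k = \<infinity>\<close> this forces \<open>G (x k)\<close> to converge to zero
  (\<open>summable_gap_imp_tendsto_zero\<close>), and all cluster points are stationary.

  The steps tend to zero by square summability. If \<open>F (x k)\<close> oscillated, then every value in some
  interval would be a cluster value, hence the value of \<open>F\<close> at a stationary point, whereas the
  complement of the stationary values is dense (\<open>convergent_compose_of_codense_cluster_values\<close>).
\<close>

section \<open>Convex analysis\<close>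

text \<open>
  An affine function fits between a convex function and a concave function below it that touch at
  a point: separate the strict epigraph of one from the hypograph of the other. The sum rule for
  subgradients and the first-order condition on a convex set are both instances of it.
\<close>
lemma convex_sandwich:
  fixes p q :: "'a::euclidean_space \<Rightarrow> real"
  assumes p: "convex_on A p" and q: "concave_on B q"
    and z: "z \<in> interior A" "z \<in> B"
    and le: "\<And>y. y \<in> A \<inter> B \<Longrightarrow> q y \<le> p y"
    and eq: "p z = q z"
  obtains u where "\<And>y. y \<in> A \<Longrightarrow> p z + u \<bullet> (y - z) \<le> p y"
    and "\<And>y. y \<in> B \<Longrightarrow> q y \<le> q z + u \<bullet> (y - z)"
proof -
  define C where "C = {(y, t). y \<in> A \<and> p y < t}"
  define D where "D = {(y, t). y \<in> B \<and> t \<le> q y}"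
  have A: "convex A" using p by (simp add: convex_on_def)
  have B: "convex B" using q by (simp add: concave_on_iff)
  have zA: "z \<in> A" using z(1) interior_subset by blast
  have "convex C"
    unfolding convex_def C_def
  proof (clarsimp, intro conjI)
    fix x t y t' and a b :: real
    assume h: "x \<in> A" "p x < t" "y \<in> A" "p y < t'" "0 \<le> a" "0 \<le> b" "a + b = 1"
    show "a *\<^sub>R x + b *\<^sub>R y \<in> A" using h A by (simp add: convexD)
    have "p (a *\<^sub>R x + b *\<^sub>R y) \<le> a * p x + b * p y"
      using h p by (simp add: convex_on_def)
    also have "\<dots> < a * t + b * t'"
    proof (cases "a = 0")
      case True
      then show ?thesis using h by simp
    next
      case False
      then show ?thesis
        using h by (intro add_less_le_mono mult_left_mono mult_strict_left_mono) auto
    qed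
    finally show "p (a *\<^sub>R x + b *\<^sub>R y) < a * t + b * t'" .
  qed
  moreover have "convex D"
    unfolding convex_def D_def
  proof (clarsimp, intro conjI)
    fix x t y t' and a b :: real
    assume h: "x \<in> B" "t \<le> q x" "y \<in> B" "t' \<le> q y" "0 \<le> a" "0 \<le> b" "a + b = 1"
    show "a *\<^sub>R x + b *\<^sub>R y \<in> B" using h B by (simp add: convexD)
    have "a * t + b * t' \<le> a * q x + b * q y"
      using h by (intro add_mono mult_left_mono) auto
    also have "\<dots> \<le> q (a *\<^sub>R x + b *\<^sub>R y)"
      using h q by (simp add: concave_on_iff)
    finally show "a * t + b * t' \<le> q (a *\<^sub>R x + b *\<^sub>R y)" .
  qed
  moreover have "(z, p z + 1) \<in> C" "(z, q z) \<in> D"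
    using zA z by (auto simp: C_def D_def)
  moreover have "C \<inter> D = {}" using le by (fastforce simp: C_def D_def)
  ultimately obtain w :: 'a and c b :: real where "(w, c) \<noteq> 0"
    and sepC: "\<And>y t. (y, t) \<in> C \<Longrightarrow> w \<bullet> y + c * t \<le> b"
    and sepD: "\<And>y t. (y, t) \<in> D \<Longrightarrow> b \<le> w \<bullet> y + c * t"
  proof -
    assume a: "\<And>w c b. (w, c) \<noteq> 0 \<Longrightarrow> (\<And>y t. (y, t) \<in> C \<Longrightarrow> w \<bullet> y + c * t \<le> b) \<Longrightarrow>
       (\<And>y t. (y, t) \<in> D \<Longrightarrow> b \<le> w \<bullet> y + c * t) \<Longrightarrow> thesis"
      "convex C" "convex D" "(z, p z + 1) \<in> C" "(z, q z) \<in> D" "C \<inter> D = {}"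
    then obtain wc :: "'a \<times> real" and b where "wc \<noteq> 0" "\<forall>x\<in>C. wc \<bullet> x \<le> b" "\<forall>x\<in>D. wc \<bullet> x \<ge> b"
      using separating_hyperplane_sets[of C D] by blast
    then show thesis using a(1)[of "fst wc" "snd wc" b]
      by (cases wc) (force simp: inner_prod_def)
  qed
  have C': "w \<bullet> y + c * p y \<le> b" if "y \<in> A" for y
  proof -
    have "((\<lambda>t. w \<bullet> y + c * t) \<longlongrightarrow> w \<bullet> y + c * p y) (at_right (p y))"
      by (intro tendsto_intros)
    moreover have "\<forall>\<^sub>F t in at_right (p y). w \<bullet> y + c * t \<le> b"
      using sepC that unfolding C_def eventually_at_filter
      by (auto intro!: always_eventually)
    ultimately show ?thesis by (simp add: tendsto_upperbound)
  qed
  have D': "b \<le> w \<bullet> y + c * q y" if "y \<in> B" for y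
    using sepD that by (auto simp: D_def)
  have b: "b = w \<bullet> z + c * p z"
    using C'[OF zA] D'[OF z(2)] eq by simp
  have "c \<le> 0"
  proof -
    have "(z, p z + 1) \<in> C" using zA by (simp add: C_def)
    from sepC[OF this] b show ?thesis by (simp add: algebra_simps)
  qed
  \<comment> \<open>A vertical hyperplane is excluded because it would have to pass through the interior
    point \<open>z\<close> of \<open>A\<close>.\<close>
  moreover have "c \<noteq> 0"
  proof
    assume c: "c = 0"
    then have "w \<noteq> 0" using \<open>(w, c) \<noteq> 0\<close> by (auto simp: zero_prod_def)
    obtain e where e: "e > 0" "cball z e \<subseteq> A"
      using z(1) by (auto simp: mem_interior_cball)
    have "z + (e / norm w) *\<^sub>R w \<in> cball z e" using \<open>w \<noteq> 0\<close> e by (simp add: dist_norm)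
    then have "w \<bullet> (z + (e / norm w) *\<^sub>R w) \<le> b" using C' e c by force
    then have "(e / norm w) * (w \<bullet> w) \<le> 0" using b c by (simp add: inner_add_right)
    moreover have "(e / norm w) * (w \<bullet> w) > 0" using \<open>w \<noteq> 0\<close> e by simp
    ultimately show False by simp
  qed
  ultimately have c: "c < 0" by simp
  show thesis
  proof (rule that[of "(- 1 / c) *\<^sub>R w"])
    fix y assume "y \<in> A"
    then have "w \<bullet> (y - z) \<le> - c * (p y - p z)"
      using C'[of y] b by (simp add: inner_diff_right algebra_simps)
    then show "p z + ((- 1 / c) *\<^sub>R w) \<bullet> (y - z) \<le> p y"
      using c by (simp add: field_simps)
  next
    fix y assume "y \<in> B"
    then have "- c * (q y - q z) \<le> w \<bullet> (y - z)"
      using D'[of y] b eq by (simp add: inner_diff_right algebra_simps)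
    then show "q y \<le> q z + ((- 1 / c) *\<^sub>R w) \<bullet> (y - z)"
      using c by (simp add: field_simps)
  qed
qed

lemma norm_convex_comb_diff_sq:
  fixes p y x :: "'a::real_inner"
  shows "(norm (p + t *\<^sub>R (y - p) - x))\<^sup>2
    = (1 - t) * (norm (p - x))\<^sup>2 + t * (norm (y - x))\<^sup>2 - t * (1 - t) * (norm (y - p))\<^sup>2"
  unfolding power2_norm_eq_inner
  by (simp add: inner_simps algebra_simps inner_commute)

lemma ereal_convexD:
  assumes "ereal_convex h" "h y \<le> ereal a" "h z \<le> ereal b" "0 \<le> t" "t \<le> 1"
  shows "h (y + t *\<^sub>R (z - y)) \<le> ereal ((1 - t) * a + t * b)"
proof -
  have "(1 - t) *\<^sub>R (y, a) + t *\<^sub>R (z, b) \<in> {(y, t::real). h y \<le> ereal t}"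
    using assms unfolding ereal_convex_def by (intro convexD) auto
  moreover have "(1 - t) *\<^sub>R y + t *\<^sub>R z = y + t *\<^sub>R (z - y)" by (simp add: algebra_simps)
  ultimately show ?thesis by simp
qed

text \<open>
  On a segment issuing from \<open>x\<close> the convexity bound is linear and the Frechet bound is linear up to
  \<open>o(t)\<close>, so letting \<open>t\<close> tend to \<open>0\<close> turns the local bound into a global one.
\<close>
lemma frechet_subdiff_convex_minorant:
  fixes h :: "'a::euclidean_space \<Rightarrow> ereal"
  assumes h: "ereal_convex h" and g: "g \<in> frechet_subdiff h x"
    and hx: "h x = ereal a" and hy: "h y \<le> ereal b"
  shows "a + g \<bullet> (y - x) \<le> b"
proof (cases "y = x")
  case True
  then show ?thesis using hx hy by simp
next
  case False
  obtain r where r: "r \<in> o[at x](\<lambda>y. norm (y - x))"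
    and ev: "\<forall>\<^sub>F y in at x. h y \<ge> h x + ereal (g \<bullet> (y - x) + r y)"
    using g by (auto simp: frechet_subdiff_def)
  define \<gamma> where "\<gamma> t = x + t *\<^sub>R (y - x)" for t :: real
  have lim: "filterlim \<gamma> (at x) (at_right 0)"
    unfolding filterlim_at
  proof (intro conjI)
    show "(\<gamma> \<longlongrightarrow> x) (at_right 0)" unfolding \<gamma>_def by (auto intro!: tendsto_eq_intros)
    show "\<forall>\<^sub>F t in at_right 0. \<gamma> t \<in> UNIV \<and> \<gamma> t \<noteq> x"
      using False by (auto simp: \<gamma>_def eventually_at_filter)
  qed
  have "((\<lambda>t. r (\<gamma> t) / norm (\<gamma> t - x)) \<longlongrightarrow> 0) (at_right 0)"
    using filterlim_compose[OF smalloD_tendsto[OF r] lim] .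
  then have "((\<lambda>t. a + g \<bullet> (y - x) + r (\<gamma> t) / norm (\<gamma> t - x) * norm (y - x))
     \<longlongrightarrow> a + g \<bullet> (y - x) + 0 * norm (y - x)) (at_right 0)"
    by (intro tendsto_intros)
  moreover have "\<forall>\<^sub>F t in at_right 0. a + g \<bullet> (y - x) + r (\<gamma> t) / norm (\<gamma> t - x) * norm (y - x) \<le> b"
  proof -
    have "\<forall>\<^sub>F t in at_right (0::real). 0 < t \<and> t < 1"
      using eventually_at_right_real[of 0 1] by simp
    moreover have "\<forall>\<^sub>F t in at_right 0. h (\<gamma> t) \<ge> h x + ereal (g \<bullet> (\<gamma> t - x) + r (\<gamma> t))"
      using lim ev by (rule eventually_compose_filterlim[rotated])
    ultimately show ?thesis
    proof eventually_elim
      case (elim t)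
      have "ereal (a + (g \<bullet> (\<gamma> t - x) + r (\<gamma> t))) \<le> h (\<gamma> t)"
        using elim hx by simp
      also have "\<dots> \<le> ereal ((1 - t) * a + t * b)"
        unfolding \<gamma>_def using elim h hx hy by (intro ereal_convexD) auto
      finally have "t * (g \<bullet> (y - x)) + r (\<gamma> t) \<le> t * (b - a)"
        by (simp add: \<gamma>_def algebra_simps)
      then have "g \<bullet> (y - x) + r (\<gamma> t) / t \<le> b - a"
        using elim by (simp add: field_simps)
      then show ?case using elim False by (simp add: \<gamma>_def)
    qed
  qed
  ultimately show ?thesis by (simp add: tendsto_upperbound)
qed

lemma affine_minorant_imp_frechet:
  fixes h :: "'a::euclidean_space \<Rightarrow> real"
  assumes e: "e > 0"
    and le: "\<And>y. y \<in> cball x e \<Longrightarrow> h x + g \<bullet> (y - x) - c * (norm (y - x))\<^sup>2 \<le> h y"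
  shows "g \<in> frechet_subdiff (\<lambda>y. ereal (h y)) x"
proof -
  have "(\<lambda>y. - c * (norm (y - x))\<^sup>2) \<in> o[at x](\<lambda>y. norm (y - x))"
  proof (rule smalloI_tendsto)
    have "((\<lambda>y. - c * norm (y - x)) \<longlongrightarrow> - c * norm (x - x)) (at x)"
      by (intro tendsto_intros)
    then show "((\<lambda>y. - c * (norm (y - x))\<^sup>2 / norm (y - x)) \<longlongrightarrow> 0) (at x)"
      by (rule tendsto_eq_rhs[OF filterlim_cong[THEN iffD1, OF refl refl _, rotated]])
         (auto simp: power2_eq_square eventually_at_filter)
    show "\<forall>\<^sub>F y in at x. norm (y - x) \<noteq> 0" by (simp add: eventually_at_filter)
  qed
  moreover have "\<forall>\<^sub>F y in at x. ereal (h y) \<ge> ereal (h x) + ereal (g \<bullet> (y - x) + - c * (norm (y - x))\<^sup>2)"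
    using eventually_at_ball[OF e, of x UNIV] by eventually_elim (use le in \<open>simp add: less_imp_le diff_add_eq flip: add_diff_eq\<close>)
  ultimately show ?thesis
    unfolding frechet_subdiff_def by (intro CollectI conjI bexI[where x = "\<lambda>y. - c * (norm (y - x))\<^sup>2"]) simp_all
qed

text \<open>
  Only points \<open>x\<close> of the ball of radius \<open>R\<close> are restricted; \<open>y\<close> is arbitrary, which is what a
  proximal step of unknown length needs. The reason is that \<open>x\<close> lies between \<open>y\<close> and the point at
  distance one from \<open>x\<close> in the direction away from \<open>y\<close>, where \<open>h\<close> is still bounded by \<open>B\<close>.
\<close>
lemma convex_on_lower_lipschitz:
  fixes h :: "'a::real_normed_vector \<Rightarrow> real"
  assumes h: "convex_on UNIV h" and b: "\<And>y. norm y \<le> R + 1 \<Longrightarrow> \<bar>h y\<bar> \<le> B"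
    and x: "norm x \<le> R"
  shows "h x - 2 * B * norm (y - x) \<le> h y"
proof (cases "y = x")
  case True
  then show ?thesis by simp
next
  case False
  define d where "d = norm (y - x)"
  define u where "u = x - (1 / d) *\<^sub>R (y - x)"
  have d: "d > 0" using False by (simp add: d_def)
  have "norm (u - x) = 1" using d by (simp add: u_def d_def)
  then have "norm u \<le> R + 1" using x norm_triangle_ineq2[of u x] by linarith
  have comb: "(d / (1 + d)) *\<^sub>R u + (1 / (1 + d)) *\<^sub>R y = x"
  proof -
    have "(1 + d) *\<^sub>R ((d / (1 + d)) *\<^sub>R u + (1 / (1 + d)) *\<^sub>R y) = d *\<^sub>R u + y"
      using d by (simp add: scaleR_add_right)
    also have "\<dots> = (1 + d) *\<^sub>R x" using d by (simp add: u_def algebra_simps)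
    finally show ?thesis using d by (metis add_pos_pos less_numeral_extra(1) less_irrefl scaleR_cancel_left)
  qed
  have "h ((d / (1 + d)) *\<^sub>R u + (1 / (1 + d)) *\<^sub>R y) \<le> (d / (1 + d)) * h u + (1 / (1 + d)) * h y"
  proof -
    have "d / (1 + d) + 1 / (1 + d) = 1" using d by (simp add: field_simps)
    moreover have "0 \<le> d / (1 + d)" "0 \<le> 1 / (1 + d)" using d by auto
    ultimately show ?thesis using h unfolding convex_on_def by blast
  qed
  then have "(1 + d) * h x \<le> (1 + d) * ((d / (1 + d)) * h u + (1 / (1 + d)) * h y)"
    using d comb by (intro mult_left_mono) auto
  also have "\<dots> = d * h u + h y" using d by (simp add: distrib_left)
  finally have "h x + d * (h x - h u) \<le> h y" by (simp add: algebra_simps)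
  moreover have "d * (- 2 * B) \<le> d * (h x - h u)"
    using b[of x] b[OF \<open>norm u \<le> R + 1\<close>] x d by (intro mult_left_mono) auto
  ultimately show ?thesis by (simp add: d_def algebra_simps)
qed

text \<open>
  The proximal objective is strongly convex with modulus \<open>1 / a\<close>, so it exceeds its minimum by at
  least \<open>(norm (y - p))\<^sup>2 / (2 * a)\<close>. To see this, compare \<open>p\<close> with the points between \<open>p\<close>
  and \<open>y\<close>, divide by the step length and let it tend to zero.
\<close>
lemma prox_three_point:
  fixes \<psi> :: "'a::euclidean_space \<Rightarrow> ereal"
  assumes \<psi>: "ereal_convex \<psi>" and X: "convex X" and a: "a > 0"
    and p: "is_arg_min (\<lambda>y. \<psi> y + ereal (1 / (2 * a) * (norm (y - x))\<^sup>2)) (\<lambda>y. y \<in> X) p"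
    and \<psi>p: "\<psi> p = ereal b" and y: "y \<in> X" "\<psi> y \<le> ereal c"
  shows "b + 1 / (2 * a) * (norm (p - x))\<^sup>2 + 1 / (2 * a) * (norm (y - p))\<^sup>2
    \<le> c + 1 / (2 * a) * (norm (y - x))\<^sup>2"
proof -
  define w where "w = 1 / (2 * a)"
  have p': "p \<in> X" and min: "\<And>z. z \<in> X \<Longrightarrow>
      \<psi> p + ereal (w * (norm (p - x))\<^sup>2) \<le> \<psi> z + ereal (w * (norm (z - x))\<^sup>2)"
    using p unfolding is_arg_min_def w_def by (auto simp: not_less)
  have main: "b + w * (norm (p - x))\<^sup>2 \<le> c + w * (norm (y - x))\<^sup>2 - (1 - t) * (w * (norm (y - p))\<^sup>2)"
    if t: "0 < t" "t < 1" for t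
  proof -
    let ?z = "p + t *\<^sub>R (y - p)"
    have "?z = (1 - t) *\<^sub>R p + t *\<^sub>R y" by (simp add: algebra_simps)
    then have "?z \<in> X" using X p' y t by (simp add: convexD)
    then have "\<psi> p + ereal (w * (norm (p - x))\<^sup>2) \<le> \<psi> ?z + ereal (w * (norm (?z - x))\<^sup>2)"
      by (rule min)
    also have "\<dots> \<le> ereal ((1 - t) * b + t * c) + ereal (w * (norm (?z - x))\<^sup>2)"
      using t \<psi>p y by (intro add_right_mono ereal_convexD[OF \<psi>]) auto
    finally have "b + w * (norm (p - x))\<^sup>2 \<le> (1 - t) * b + t * c + w * (norm (?z - x))\<^sup>2"
      using \<psi>p by simp
    then have "t * (b + w * (norm (p - x))\<^sup>2)
       \<le> t * (c + w * (norm (y - x))\<^sup>2 - (1 - t) * (w * (norm (y - p))\<^sup>2))"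
      unfolding norm_convex_comb_diff_sq by (simp add: algebra_simps)
    then show ?thesis using t by simp
  qed
  have "((\<lambda>t. c + w * (norm (y - x))\<^sup>2 - (1 - t) * (w * (norm (y - p))\<^sup>2))
    \<longlongrightarrow> c + w * (norm (y - x))\<^sup>2 - (1 - 0) * (w * (norm (y - p))\<^sup>2)) (at_right 0)"
    by (intro tendsto_intros)
  moreover have "\<forall>\<^sub>F t in at_right 0. b + w * (norm (p - x))\<^sup>2
     \<le> c + w * (norm (y - x))\<^sup>2 - (1 - t) * (w * (norm (y - p))\<^sup>2)"
    using eventually_at_right_real[OF zero_less_one] by eventually_elim (use main in auto)
  ultimately have "b + w * (norm (p - x))\<^sup>2
     \<le> c + w * (norm (y - x))\<^sup>2 - (1 - 0) * (w * (norm (y - p))\<^sup>2)"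
    by (rule tendsto_lowerbound) simp
  then show ?thesis by (simp add: w_def)
qed

lemma convex_on_sq_dist_add:
  fixes c :: real and z :: "'a::real_inner"
  assumes h: "convex_on A (\<lambda>y. h y + c / 2 * (norm (y - z))\<^sup>2)" and d: "c \<le> d"
  shows "convex_on A (\<lambda>y. h y + d / 2 * (norm (y - z))\<^sup>2)"
proof -
  have A: "convex A" using h by (simp add: convex_on_def)
  have "convex_on A (\<lambda>y. (norm (y - z))\<^sup>2)"
    unfolding convex_on_def
  proof (intro conjI ballI allI impI A)
    fix x y :: 'a and u v :: real assume uv: "0 \<le> u" "0 \<le> v" "u + v = 1"
    then have u: "u = 1 - v" by simp
    have *: "u *\<^sub>R x + v *\<^sub>R y = x + v *\<^sub>R (y - x)" by (simp add: u algebra_simps)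
    show "(norm (u *\<^sub>R x + v *\<^sub>R y - z))\<^sup>2 \<le> u * (norm (x - z))\<^sup>2 + v * (norm (y - z))\<^sup>2"
      unfolding * norm_convex_comb_diff_sq using uv by (simp add: u)
  qed
  then have "convex_on A (\<lambda>y. (h y + c / 2 * (norm (y - z))\<^sup>2) + (d - c) / 2 * (norm (y - z))\<^sup>2)"
    using d by (intro convex_on_add convex_on_cmul h) auto
  then show ?thesis by (simp add: diff_divide_distrib left_diff_distrib)
qed

text \<open>
  After a multiple of \<open>(norm (y - z))\<^sup>2\<close> is added to \<open>h\<close>, the problem becomes a convex one with
  minimizer \<open>z\<close>, and this multiple does not change the Frechet subgradients at \<open>z\<close>. A first
  application of the sandwich lemma gives a subgradient \<open>w\<close> of the sum that is nonnegative
  along \<open>X\<close>; a second one splits \<open>w\<close> between the two summands.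
\<close>
lemma weakly_convex_minimizer_stationary:
  fixes h \<phi> :: "'a::euclidean_space \<Rightarrow> real"
  assumes X: "convex X" "z \<in> X" and \<phi>: "convex_on UNIV \<phi>" and e: "e > 0"
    and h: "convex_on (cball z e) (\<lambda>y. h y + c / 2 * (norm (y - z))\<^sup>2)"
    and min: "\<And>y. y \<in> X \<inter> cball z e \<Longrightarrow> h z + \<phi> z \<le> h y + \<phi> y + d / 2 * (norm (y - z))\<^sup>2"
  shows "\<exists>u \<in> frechet_subdiff (\<lambda>y. ereal (h y)) z. \<exists>v \<in> frechet_subdiff (\<lambda>y. ereal (\<phi> y)) z.
    \<forall>y\<in>X. (u + v) \<bullet> (y - z) \<ge> 0"
proof -
  define m where "m = max c d"
  define H where "H y = h y + m / 2 * (norm (y - z))\<^sup>2" for y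
  have H: "convex_on (cball z e) H"
    unfolding H_def by (rule convex_on_sq_dist_add[OF h]) (simp add: m_def)
  have Hz: "H z = h z" by (simp add: H_def)
  have zint: "z \<in> interior (cball z e)" using e by simp
  have \<phi>': "convex_on (cball z e) \<phi>" by (rule convex_on_subset[OF \<phi>]) auto
  have conv: "convex_on (cball z e) (\<lambda>y. H y + \<phi> y)" by (rule convex_on_add[OF H \<phi>'])
  have conc: "concave_on (X \<inter> cball z e) (\<lambda>y. H z + \<phi> z)"
    using X by (simp add: concave_on_iff convex_Int flip: distrib_right)
  have le: "H z + \<phi> z \<le> H y + \<phi> y" if "y \<in> cball z e \<inter> (X \<inter> cball z e)" for y
  proof -
    have "h z + \<phi> z \<le> h y + \<phi> y + d / 2 * (norm (y - z))\<^sup>2" using min that by blast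
    also have "d / 2 * (norm (y - z))\<^sup>2 \<le> m / 2 * (norm (y - z))\<^sup>2"
      by (intro mult_right_mono) (auto simp: m_def)
    finally show ?thesis by (simp add: H_def)
  qed
  have "z \<in> X \<inter> cball z e" using X e by simp
  then obtain w where w1: "\<And>y. y \<in> cball z e \<Longrightarrow> H z + \<phi> z + w \<bullet> (y - z) \<le> H y + \<phi> y"
    and w2: "\<And>y. y \<in> X \<inter> cball z e \<Longrightarrow> 0 \<le> w \<bullet> (y - z)"
    by (rule convex_sandwich[OF conv conc zint _ le]) auto
  have "convex_on UNIV (\<lambda>y. - \<phi> z + \<phi> y)"
  proof (rule convex_on_add[OF _ \<phi>])
    show "convex_on UNIV (\<lambda>y. - \<phi> z)"
      unfolding convex_on_def
    proof (intro conjI ballI allI impI)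
      fix u v :: real assume "u + v = 1"
      then have u: "u = 1 - v" by simp
      show "- \<phi> z \<le> u * - \<phi> z + v * - \<phi> z" unfolding u by (simp add: algebra_simps)
    qed simp
  qed
  then have conc2: "concave_on UNIV (\<lambda>y. \<phi> z - \<phi> y)"
    by (simp add: concave_on_def)
  have conv3: "convex_on (cball z e) (\<lambda>y. H y - H z - w \<bullet> (y - z))"
  proof -
    have "convex_on (cball z e) (\<lambda>y. - H z - w \<bullet> (y - z))"
      unfolding convex_on_def
    proof (intro conjI ballI allI impI)
      fix x y :: 'a and u v :: real assume "u + v = 1"
      then have u: "u = 1 - v" by simp
      show "- H z - w \<bullet> (u *\<^sub>R x + v *\<^sub>R y - z) \<le> u * (- H z - w \<bullet> (x - z)) + v * (- H z - w \<bullet> (y - z))"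
        unfolding u by (simp add: inner_simps algebra_simps)
    qed simp
    from convex_on_add[OF H this] show ?thesis by (simp add: algebra_simps)
  qed
  have le2: "\<phi> z - \<phi> y \<le> H y - H z - w \<bullet> (y - z)" if "y \<in> cball z e \<inter> UNIV" for y
    using w1[of y] that by simp
  obtain u where u1: "\<And>y. y \<in> cball z e \<Longrightarrow> u \<bullet> (y - z) \<le> H y - H z - w \<bullet> (y - z)"
    and u2: "\<And>y. \<phi> z - \<phi> y \<le> u \<bullet> (y - z)"
    by (rule convex_sandwich[OF conv3 conc2 zint _ le2]) auto
  have "w + u \<in> frechet_subdiff (\<lambda>y. ereal (h y)) z"
  proof (rule affine_minorant_imp_frechet[OF e])
    fix y assume "y \<in> cball z e"
    from u1[OF this] show "h z + (w + u) \<bullet> (y - z) - m / 2 * (norm (y - z))\<^sup>2 \<le> h y"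
      by (simp add: H_def inner_add_left)
  qed
  moreover have "- u \<in> frechet_subdiff (\<lambda>y. ereal (\<phi> y)) z"
  proof (rule affine_minorant_imp_frechet[OF e])
    fix y
    show "\<phi> z + (- u) \<bullet> (y - z) - 0 * (norm (y - z))\<^sup>2 \<le> \<phi> y"
      using u2[of y] by simp
  qed
  moreover have "(w + u + - u) \<bullet> (y - z) \<ge> 0" if y: "y \<in> X" for y
  proof (cases "y = z")
    case False
    define t where "t = min 1 (e / norm (y - z))"
    have t: "0 < t" "t \<le> 1" "t * norm (y - z) \<le> e"
      using False e by (auto simp: t_def min_def field_simps)
    let ?y = "z + t *\<^sub>R (y - z)"
    have "?y = (1 - t) *\<^sub>R z + t *\<^sub>R y" by (simp add: algebra_simps)
    then have "?y \<in> X" using X y t by (simp add: convexD)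
    moreover have "?y \<in> cball z e" using t by (simp add: dist_norm)
    ultimately have "0 \<le> w \<bullet> (?y - z)" using w2 by blast
    then have "0 \<le> t * (w \<bullet> (y - z))" by simp
    then show ?thesis using t by (simp add: zero_le_mult_iff)
  qed simp
  ultimately show ?thesis by blast
qed

section \<open>Sequences\<close>

text \<open>
  The total distance covered at times with \<open>G (x k) \<ge> \<eta>\<close> is at most \<open>c / \<eta>\<close> times
  \<open>\<Sum>k. \<alpha> k * G (x k) * r k\<close>, hence finite. Since \<open>\<Sum>k. \<alpha> k\<close> diverges, \<open>G (x k)\<close> drops
  below \<open>\<eta>\<close> again and again. If it also exceeded \<open>2 * \<eta>\<close> again and again, then late passages from
  one level to the other would cover arbitrarily small distances, against uniform continuity.
\<close>
lemma summable_gap_imp_tendsto_zero: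
  fixes x :: "nat \<Rightarrow> 'a::metric_space" and G :: "'a \<Rightarrow> real" and \<alpha> r :: "nat \<Rightarrow> real"
  assumes G: "uniformly_continuous_on K G" "\<And>y. y \<in> K \<Longrightarrow> 0 \<le> G y"
    and x: "\<And>k. x k \<in> K"
    and \<alpha>: "\<And>k. 0 \<le> \<alpha> k" "\<not> summable \<alpha>" and r: "\<And>k. 1 \<le> r k"
    and sum: "summable (\<lambda>k. \<alpha> k * G (x k) * r k)"
    and step: "\<And>k. dist (x (Suc k)) (x k) \<le> c * (\<alpha> k * r k)" and c: "0 \<le> c"
    and step0: "(\<lambda>k. dist (x (Suc k)) (x k)) \<longlonglongrightarrow> 0"
  shows "(\<lambda>k. G (x k)) \<longlonglongrightarrow> 0"
proof (rule ccontr)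
  assume "\<not> ?thesis"
  then obtain \<eta>' where "\<eta>' > 0" and often: "\<And>N. \<exists>n\<ge>N. \<not> \<bar>G (x n)\<bar> < \<eta>'"
    unfolding LIMSEQ_iff by force
  define \<eta> where "\<eta> = \<eta>' / 2"
  have \<eta>: "\<eta> > 0" using \<open>\<eta>' > 0\<close> by (simp add: \<eta>_def)
  have G0: "0 \<le> G (x k)" for k using G x by simp
  have high: "\<exists>n\<ge>N. 2 * \<eta> \<le> G (x n)" for N
    using often[of N] G0 by (auto simp: \<eta>_def not_less)
  have low: "\<exists>n\<ge>N. G (x n) < \<eta>" for N
  proof (rule ccontr)
    assume "\<not> ?thesis"
    then have *: "\<And>n. n \<ge> N \<Longrightarrow> \<eta> \<le> G (x n)" by (auto simp: not_less)
    have "summable (\<lambda>k. (1 / \<eta>) * (\<alpha> k * G (x k) * r k))" using sum by (rule summable_mult)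
    then have "summable \<alpha>"
    proof (rule summable_comparison_test'[where N = N])
      fix n assume n: "N \<le> n"
      have "\<alpha> n * (\<eta> * 1) \<le> \<alpha> n * (G (x n) * r n)"
        using *[OF n] r[of n] \<alpha>(1)[of n] \<eta> G0 by (intro mult_left_mono mult_mono) auto
      then show "norm (\<alpha> n) \<le> 1 / \<eta> * (\<alpha> n * G (x n) * r n)"
        using \<alpha>(1)[of n] \<eta> by (simp add: field_simps)
    qed
    with \<alpha>(2) show False by simp
  qed
  obtain \<tau> where \<tau>: "\<tau> > 0"
    and uc: "\<And>y z. y \<in> K \<Longrightarrow> z \<in> K \<Longrightarrow> dist z y < \<tau> \<Longrightarrow> dist (G z) (G y) < \<eta>"
    using G(1) \<eta> unfolding uniformly_continuous_on_def by blast
  obtain N1 where N1: "\<And>k. k \<ge> N1 \<Longrightarrow> dist (x (Suc k)) (x k) < \<tau> / 2"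
    using order_tendstoD(2)[OF step0, of "\<tau> / 2"] \<tau>
    unfolding eventually_sequentially by auto
  \<comment> \<open>chosen such that \<open>c / \<eta> * d \<le> \<tau> / 2\<close>; the other half of \<open>\<tau>\<close> pays for the first step\<close>
  define d where "d = \<tau> * \<eta> / (2 * (c + 1))"
  have d: "d > 0" using \<tau> \<eta> c by (simp add: d_def)
  obtain N2 where N2: "\<And>m n. m \<ge> N2 \<Longrightarrow> norm (\<Sum>k=m..<n. \<alpha> k * G (x k) * r k) < d"
    using sum d unfolding summable_Cauchy by blast
  obtain m0 where m0: "m0 \<ge> max N1 N2" "G (x m0) < \<eta>" using low by blast
  obtain n where n: "n \<ge> m0" "2 * \<eta> \<le> G (x n)" using high by blast
  \<comment> \<open>the last time before \<open>n\<close> at which the gap is below \<open>\<eta>\<close>: from then on until \<open>n\<close> all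
    distances are charged to the summable series\<close>
  define m where "m = (GREATEST k. k \<le> n \<and> G (x k) < \<eta>)"
  have m: "m \<le> n \<and> G (x m) < \<eta>"
    unfolding m_def by (rule GreatestI_nat[where P = "\<lambda>k. k \<le> n \<and> G (x k) < \<eta>" and k = m0 and b = n]) (use n m0 in auto)
  have mm0: "m0 \<le> m"
    unfolding m_def by (rule Greatest_le_nat[where P = "\<lambda>k. k \<le> n \<and> G (x k) < \<eta>" and b = n]) (use n m0 in auto)
  have between: "\<eta> \<le> G (x k)" if "m < k" "k \<le> n" for k
  proof (rule ccontr)
    assume "\<not> ?thesis"
    then have "k \<le> m" unfolding m_def
      by (intro Greatest_le_nat[where P = "\<lambda>k. k \<le> n \<and> G (x k) < \<eta>" and b = n]) (use that in auto)
    then show False using that by simp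
  qed
  have mn: "m < n" using m n \<eta> by (cases "m = n") auto
  have travel: "dist (x k) (x (Suc m)) \<le> (\<Sum>j=Suc m..<k. dist (x (Suc j)) (x j))" if "Suc m \<le> k" for k
    using that
  proof (induction k rule: dec_induct)
    case (step k)
    have "dist (x (Suc k)) (x (Suc m)) \<le> dist (x (Suc k)) (x k) + dist (x k) (x (Suc m))"
      by (rule dist_triangle)
    then show ?case using step by simp
  qed simp
  have "dist (x n) (x (Suc m)) \<le> (\<Sum>j=Suc m..<n. dist (x (Suc j)) (x j))"
    using travel mn by simp
  also have "\<dots> \<le> (\<Sum>j=Suc m..<n. c / \<eta> * (\<alpha> j * G (x j) * r j))"
  proof (rule sum_mono)
    fix j assume j: "j \<in> {Suc m..<n}"
    have "c * (\<alpha> j * r j) * \<eta> \<le> c * (\<alpha> j * r j) * G (x j)"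
      using j between[of j] c \<alpha>(1)[of j] r[of j] by (intro mult_left_mono) auto
    then have "c * (\<alpha> j * r j) \<le> c / \<eta> * (\<alpha> j * G (x j) * r j)"
      using \<eta> by (simp add: field_simps)
    with step[of j] show "dist (x (Suc j)) (x j) \<le> c / \<eta> * (\<alpha> j * G (x j) * r j)" by simp
  qed
  also have "\<dots> = c / \<eta> * (\<Sum>j=Suc m..<n. \<alpha> j * G (x j) * r j)"
    by (simp add: sum_distrib_left)
  also have "\<dots> \<le> c / \<eta> * d"
    using N2[of "Suc m" n] m0 mm0 c \<eta> by (intro mult_left_mono) auto
  also have "\<dots> = (c / (c + 1)) * (\<tau> / 2)" using \<eta> c by (simp add: d_def field_simps)
  also have "\<dots> \<le> 1 * (\<tau> / 2)" using c \<tau> by (intro mult_right_mono) auto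
  finally have "dist (x n) (x (Suc m)) \<le> \<tau> / 2" by simp
  moreover have "dist (x (Suc m)) (x m) < \<tau> / 2" using N1 m0 mm0 by simp
  ultimately have "dist (x n) (x m) < \<tau>" using dist_triangle[of "x n" "x m" "x (Suc m)"] by linarith
  then have "dist (G (x n)) (G (x m)) < \<eta>" using uc x by blast
  then have "G (x n) - G (x m) < \<eta>" unfolding dist_real_def by linarith
  then show False using n m by linarith
qed

text \<open>
  A real sequence with vanishing increments that oscillates between two levels has every
  intermediate value as a cluster point. Some value between the levels lies outside \<open>T\<close>.
\<close>
lemma convergent_if_cluster_values_codense:
  fixes a :: "nat \<Rightarrow> real"
  assumes bdd: "bounded (range a)" and step: "(\<lambda>k. a (Suc k) - a k) \<longlonglongrightarrow> 0"
    and T: "closure (- T) = UNIV"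
    and cluster: "\<And>c r. strict_mono (r :: nat \<Rightarrow> nat) \<Longrightarrow> (a \<circ> r) \<longlonglongrightarrow> c \<Longrightarrow> c \<in> T"
  shows "convergent a"
proof (rule ccontr)
  assume nc: "\<not> convergent a"
  obtain l r where r: "strict_mono r" "(a \<circ> r) \<longlonglongrightarrow> l"
    using bounded_imp_convergent_subsequence[OF bdd] by blast
  have "\<not> a \<longlonglongrightarrow> l" using nc convergentI by blast
  then obtain e where e: "e > 0" and far: "\<And>N. \<exists>n\<ge>N. \<not> \<bar>a n - l\<bar> < e"
    unfolding LIMSEQ_iff by auto
  have near: "\<exists>n\<ge>N. \<bar>a n - l\<bar> < d" if "d > 0" for d N
  proof -
    have "\<forall>\<^sub>F n in sequentially. dist ((a \<circ> r) n) l < d" using r(2) that by (rule tendstoD)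
    then obtain M where "\<forall>n\<ge>M. dist ((a \<circ> r) n) l < d" unfolding eventually_sequentially ..
    then have "dist ((a \<circ> r) (max M N)) l < d" by simp
    then have "\<bar>a (r (max M N)) - l\<bar> < d" by (simp add: dist_real_def)
    moreover have "r (max M N) \<ge> N" using seq_suble[OF r(1), of "max M N"] by simp
    ultimately show ?thesis by blast
  qed
  have "(\<forall>N. \<exists>n\<ge>N. a n \<le> l - e) \<or> (\<forall>N. \<exists>n\<ge>N. l + e \<le> a n)"
  proof (rule ccontr)
    assume "\<not> ?thesis"
    then have "\<exists>N. \<not> (\<exists>n\<ge>N. a n \<le> l - e)" "\<exists>N. \<not> (\<exists>n\<ge>N. l + e \<le> a n)" by simp_all
    then obtain N N' where N: "\<not> (\<exists>n\<ge>N. a n \<le> l - e)" "\<not> (\<exists>n\<ge>N'. l + e \<le> a n)" by (elim exE)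
    have "l - e < a n" "a n < l + e" if "n \<ge> max N N'" for n
      using N that by (meson max.boundedE not_le)+
    then have "\<bar>a n - l\<bar> < e" if "n \<ge> max N N'" for n using that by (fastforce simp: abs_less_iff)
    then show False using far by blast
  qed
  moreover have in_gap: "\<exists>c. u < c \<and> c < v \<and> c \<notin> T" if "u < v" for u v :: real
  proof -
    have "{u<..<v} \<inter> - T \<noteq> {}"
      using T that open_Int_closure_eq_empty[of "{u<..<v}" "- T"] by auto
    then show ?thesis by auto
  qed
  ultimately obtain c where c: "c \<notin> T"
    and lo: "\<And>N. \<exists>n\<ge>N. a n < c" and hi: "\<And>N. \<exists>n\<ge>N. c \<le> a n"
  proof (elim disjE)
    assume a: "\<forall>N. \<exists>n\<ge>N. a n \<le> l - e"
    obtain c where "l - e < c" "c < l" "c \<notin> T" using in_gap[of "l - e" l] e by auto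
    moreover have "\<exists>n\<ge>N. c \<le> a n" for N
      using near[of "l - c" N] \<open>c < l\<close> by (force simp: abs_less_iff)
    moreover have "\<exists>n\<ge>N. a n < c" for N using a \<open>l - e < c\<close> by force
    ultimately show ?thesis using that by blast
  next
    assume a: "\<forall>N. \<exists>n\<ge>N. l + e \<le> a n"
    obtain c where "l < c" "c < l + e" "c \<notin> T" using in_gap[of l "l + e"] e by auto
    moreover have "\<exists>n\<ge>N. a n < c" for N
      using near[of "c - l" N] \<open>l < c\<close> by (force simp: abs_less_iff)
    moreover have "\<exists>n\<ge>N. c \<le> a n" for N using a \<open>c < l + e\<close> by force
    ultimately show ?thesis using that by blast
  qed
  have cross: "\<exists>n\<ge>N. a n < c \<and> c \<le> a (Suc n)" for N
  proof -
    obtain m where m: "m \<ge> N" "a m < c" using lo by blast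
    obtain n where n: "n \<ge> m" "c \<le> a n" using hi by blast
    from n(1) have "a n < c \<or> (\<exists>n\<ge>N. a n < c \<and> c \<le> a (Suc n))"
    proof (induction n rule: dec_induct)
      case (step k)
      then show ?case using m(1) by (meson le_trans not_less)
    qed (use m in simp)
    then show ?thesis using n by auto
  qed
  define s where "s = enumerate {n. a n < c \<and> c \<le> a (Suc n)}"
  have inf: "infinite {n. a n < c \<and> c \<le> a (Suc n)}"
    unfolding infinite_nat_iff_unbounded_le using cross by auto
  have s: "strict_mono s" unfolding s_def by (rule strict_mono_enumerate[OF inf])
  have sn: "a (s n) < c" "c \<le> a (Suc (s n))" for n
    using enumerate_in_set[OF inf, of n] by (auto simp: s_def)
  have lim0: "(\<lambda>n. a (Suc (s n)) - a (s n)) \<longlonglongrightarrow> 0"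
    using LIMSEQ_subseq_LIMSEQ[OF step s] by (simp add: o_def)
  have "(\<lambda>n. c - a (s n)) \<longlonglongrightarrow> 0"
  proof (rule tendsto_sandwich[OF _ _ tendsto_const lim0])
    show "\<forall>\<^sub>F n in sequentially. 0 \<le> c - a (s n)" using sn(1) by (intro always_eventually) (simp add: less_imp_le)
    show "\<forall>\<^sub>F n in sequentially. c - a (s n) \<le> a (Suc (s n)) - a (s n)" using sn(2) by auto
  qed
  then have "(\<lambda>n. c - (c - a (s n))) \<longlonglongrightarrow> c - 0" by (intro tendsto_intros)
  then have "(a \<circ> s) \<longlonglongrightarrow> c" by (simp add: o_def)
  with cluster[OF s] c show False by blast
qed

lemma convergent_compose_of_codense_cluster_values:
  fixes x :: "nat \<Rightarrow> 'a::metric_space" and F :: "'a \<Rightarrow> real"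
  assumes K: "compact K" "\<And>k. x k \<in> K" and F: "continuous_on K F"
    and step: "(\<lambda>k. dist (x (Suc k)) (x k)) \<longlonglongrightarrow> 0"
    and cluster: "\<And>r z. strict_mono (r :: nat \<Rightarrow> nat) \<Longrightarrow> (\<lambda>k. x (r k)) \<longlonglongrightarrow> z \<Longrightarrow> z \<in> T"
    and T: "closure (- (F ` T)) = UNIV"
  shows "convergent (\<lambda>k. F (x k))"
proof (rule convergent_if_cluster_values_codense[OF _ _ T])
  have "bounded (F ` K)" using K(1) F compact_continuous_image compact_imp_bounded by blast
  then show "bounded (range (\<lambda>k. F (x k)))" by (rule bounded_subset) (use K(2) in auto)
  have uc: "uniformly_continuous_on K F" using F K(1) by (rule compact_uniformly_continuous)
  have "(\<lambda>k. dist (F (x (Suc k))) (F (x k))) \<longlonglongrightarrow> 0"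
    using uc step K(2) unfolding uniformly_continuous_on_sequentially by simp
  then show "(\<lambda>k. F (x (Suc k)) - F (x k)) \<longlonglongrightarrow> 0"
    by (simp add: dist_real_def tendsto_rabs_zero_iff)
next
  fix c and r :: "nat \<Rightarrow> nat" assume r: "strict_mono r" and lim: "((\<lambda>k. F (x k)) \<circ> r) \<longlonglongrightarrow> c"
  have "\<forall>n. (x \<circ> r) n \<in> K" using K(2) by simp
  then obtain z r' where z: "z \<in> K" and r': "strict_mono (r' :: nat \<Rightarrow> nat)"
    and lz: "((x \<circ> r) \<circ> r') \<longlonglongrightarrow> z"
    using K(1) unfolding compact_def by metis
  have "z \<in> T" using cluster[of "r \<circ> r'" z] strict_mono_o[OF r r'] lz by (simp add: o_def)
  moreover have "(\<lambda>n. F (x (r (r' n)))) \<longlonglongrightarrow> F z"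
    using lz K(2) z by (intro continuous_on_tendsto_compose[OF F]) (auto simp: o_def)
  moreover have "(\<lambda>n. F (x (r (r' n)))) \<longlonglongrightarrow> c"
    using LIMSEQ_subseq_LIMSEQ[OF lim r'] by (simp add: o_def)
  ultimately show "c \<in> F ` T" using LIMSEQ_unique by blast
qed

section \<open>Measurability and independence\<close>

lemma dense_seq_ex:
  fixes A :: "'a::euclidean_space set"
  assumes "A \<noteq> {}"
  obtains d :: "nat \<Rightarrow> 'a" where "range d \<subseteq> A" "A \<subseteq> closure (range d)"
proof -
  obtain D where D: "countable D" "D \<subseteq> A" "A \<subseteq> closure D" using separable by blast
  then have "D \<noteq> {}" using assms by auto
  then show thesis using that[of "from_nat_into D"] D by (simp add: range_from_nat_into)
qed

text \<open>
  A function that is measurable in one argument and continuous in the other is jointly measurable: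
  replace \<open>x\<close> by countably-valued approximations from a dense sequence of \<open>X\<close> and pass to the limit.
\<close>
lemma caratheodory_measurable_pair:
  fixes f :: "'a::euclidean_space \<Rightarrow> 's \<Rightarrow> real"
  assumes x: "x \<in> borel_measurable M" and xX: "\<And>\<omega>. \<omega> \<in> space M \<Longrightarrow> x \<omega> \<in> X"
    and meas: "\<And>y. f y \<in> borel_measurable P"
    and cont: "\<And>s. s \<in> space P \<Longrightarrow> continuous_on X (\<lambda>y. f y s)"
  shows "(\<lambda>(\<omega>, s). f (x \<omega>) s) \<in> borel_measurable (M \<Otimes>\<^sub>M P)"
proof (cases "X = {}")
  case True
  then have "space (M \<Otimes>\<^sub>M P) = {}" using xX by (auto simp: space_pair_measure)
  then show ?thesis by (auto simp: measurable_def)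
next
  case False
  obtain d :: "nat \<Rightarrow> 'a" where d: "range d \<subseteq> X" "X \<subseteq> closure (range d)"
    using dense_seq_ex[OF False] .
  define i where "i n \<omega> = (LEAST j. dist (d j) (x \<omega>) < 1 / Suc n)" for n \<omega>
  have i: "dist (d (i n \<omega>)) (x \<omega>) < 1 / Suc n" if "\<omega> \<in> space M" for n \<omega>
  proof -
    have "x \<omega> \<in> closure (range d)" using xX[OF that] d by auto
    then have "\<exists>j. dist (d j) (x \<omega>) < 1 / Suc n"
      unfolding closure_approachable by (auto dest!: spec[of _ "1 / Suc n"])
    then show ?thesis unfolding i_def by (rule LeastI_ex)
  qed
  have im: "i n \<in> measurable M (count_space UNIV)" for n
    unfolding i_def using x by measurable
  show ?thesis
  proof (rule borel_measurable_LIMSEQ_real)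
    fix \<omega>s assume "\<omega>s \<in> space (M \<Otimes>\<^sub>M P)"
    then obtain \<omega> s where \<omega>s: "\<omega>s = (\<omega>, s)" "\<omega> \<in> space M" "s \<in> space P"
      by (auto simp: space_pair_measure)
    have "(\<lambda>n. dist (d (i n \<omega>)) (x \<omega>)) \<longlonglongrightarrow> 0"
      using i[OF \<omega>s(2)]
      by (intro tendsto_sandwich[OF _ _ tendsto_const LIMSEQ_inverse_real_of_nat])
         (auto simp: inverse_eq_divide intro!: always_eventually less_imp_le)
    then have "(\<lambda>n. d (i n \<omega>)) \<longlonglongrightarrow> x \<omega>" using tendsto_dist_iff by blast
    then have "(\<lambda>n. f (d (i n \<omega>)) s) \<longlonglongrightarrow> f (x \<omega>) s"
      using cont[OF \<omega>s(3)] xX[OF \<omega>s(2)] d(1)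
      by (intro continuous_on_tendsto_compose[where s = X and f = "\<lambda>y. f y s"])
         (auto intro!: always_eventually)
    then show "(\<lambda>n. case \<omega>s of (\<omega>, s) \<Rightarrow> f (d (i n \<omega>)) s) \<longlonglongrightarrow> (case \<omega>s of (\<omega>, s) \<Rightarrow> f (x \<omega>) s)"
      by (simp add: \<omega>s)
  next
    fix n
    have "(\<lambda>\<omega>s. (\<lambda>j \<omega>s. f (d j) (snd \<omega>s)) (i n (fst \<omega>s)) \<omega>s) \<in> borel_measurable (M \<Otimes>\<^sub>M P)"
    proof (rule measurable_compose_countable)
      show "(\<lambda>\<omega>s. i n (fst \<omega>s)) \<in> measurable (M \<Otimes>\<^sub>M P) (count_space UNIV)"
        using im by measurable
      show "\<And>j. (\<lambda>\<omega>s. f (d j) (snd \<omega>s)) \<in> borel_measurable (M \<Otimes>\<^sub>M P)"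
        using meas by measurable
    qed
    then show "(\<lambda>(\<omega>, s). f (d (i n \<omega>)) s) \<in> borel_measurable (M \<Otimes>\<^sub>M P)"
      by (simp add: case_prod_beta')
  qed
qed

lemma space_past [simp]: "space (past \<Omega> P S k) = space \<Omega>"
  unfolding past_def by (rule space_measure_of) auto

lemma sets_past: "sets (past \<Omega> P S k)
    = sigma_sets (space \<Omega>) (\<Union>i\<in>{..<k}. {S i -` A \<inter> space \<Omega> | A. A \<in> sets P})"
  unfolding past_def by (rule sets_measure_of) auto

text \<open>
  The identity, seen as a map into the coarser space of the past, makes the past a random element,
  so that its joint law with the next sample can be computed.
\<close>
lemma (in prob_space) past_measurable_id:
  assumes "\<And>i. S i \<in> measurable M P"
  shows "(\<lambda>\<omega>. \<omega>) \<in> measurable M (past M P S k)"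
  unfolding past_def
  by (rule measurable_measure_of) (use assms in \<open>auto intro: measurable_sets\<close>)

lemma past_mono: "j \<le> k \<Longrightarrow> sets (past \<Omega> P S j) \<subseteq> sets (past \<Omega> P S k)"
  unfolding sets_past by (intro sigma_sets_mono' UN_mono) auto

lemma (in prob_space) indep_past_fresh:
  assumes S: "indep_vars (\<lambda>_. P) S UNIV"
  shows "indep_set (sets (past M P S k)) (sigma_sets (space M) {S k -` A \<inter> space M | A. A \<in> sets P})"
proof -
  define E where "E i = {S i -` A \<inter> space M | A. A \<in> sets P}" for i
  have stable: "Int_stable (E i)" for i
  proof (rule Int_stableI)
    fix a b assume "a \<in> E i" "b \<in> E i"
    then obtain A B where "A \<in> sets P" "B \<in> sets P" "a = S i -` A \<inter> space M" "b = S i -` B \<inter> space M"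
      by (auto simp: E_def)
    then show "a \<inter> b \<in> E i" unfolding E_def by (intro CollectI exI[of _ "A \<inter> B"]) auto
  qed
  have "indep_sets (\<lambda>b. sigma_sets (space M) (\<Union>i\<in>case_bool {..<k} {k} b. E i)) (UNIV :: bool set)"
  proof (rule indep_sets_collect_sigma)
    show "indep_sets E (\<Union>j\<in>UNIV. case_bool {..<k} {k} j)"
      using S unfolding indep_vars_def2 E_def by (auto intro: indep_sets_mono_index)
    show "disjoint_family_on (case_bool {..<k} {k}) (UNIV :: bool set)"
      by (auto simp: disjoint_family_on_def split: bool.splits)
  qed (rule stable)
  then have ind: "indep_set (sigma_sets (space M) (\<Union>i\<in>{..<k}. E i)) (sigma_sets (space M) (E k))"
    unfolding indep_set_def by (rule indep_sets_cong[THEN iffD1, rotated -1]) (auto split: bool.split)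
  then show ?thesis by (simp add: sets_past E_def)
qed

text \<open>
  The joint law of the past and the next sample is a product, so conditioning on the past amounts
  to integrating over the sample with the past held fixed. This replaces conditional expectations.
\<close>
lemma (in prob_space) nn_integral_past_fresh:
  assumes S: "indep_vars (\<lambda>_. P) S UNIV" and distr: "distr M P (S k) = P"
    and P: "prob_space P"
    and h: "h \<in> borel_measurable (past M P S k \<Otimes>\<^sub>M P)"
  shows "(\<integral>\<^sup>+\<omega>. h (\<omega>, S k \<omega>) \<partial>M) = (\<integral>\<^sup>+\<omega>. (\<integral>\<^sup>+s. h (\<omega>, s) \<partial>P) \<partial>M)"
proof -
  interpret P: prob_space P by (rule P)
  let ?N = "past M P S k"
  have Sm: "S k \<in> measurable M P" using S by (auto simp: indep_vars_def)
  have idm: "(\<lambda>\<omega>. \<omega>) \<in> measurable M ?N"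
    using S by (intro past_measurable_id) (auto simp: indep_vars_def)
  let ?D = "distr M ?N (\<lambda>\<omega>. \<omega>)"
  interpret D: prob_space ?D by (rule prob_space_distr[OF idm])
  have sub: "sets ?N \<subseteq> sets M"
  proof
    fix A assume "A \<in> sets ?N"
    with measurable_sets[OF idm this] sets.sets_into_space[OF this] show "A \<in> sets M"
      by (simp add: Int_absorb2)
  qed
  have eq: "?D \<Otimes>\<^sub>M P = distr M (?N \<Otimes>\<^sub>M P) (\<lambda>\<omega>. (\<omega>, S k \<omega>))"
  proof (rule pair_measure_eqI)
    fix A B assume A: "A \<in> sets ?D" and B: "B \<in> sets P"
    have AM: "A \<in> sets M" "A \<subseteq> space M" using A sub sets.sets_into_space by auto
    let ?B = "S k -` B \<inter> space M"
    have "prob (A \<inter> ?B) = prob A * prob ?B"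
      using indep_past_fresh[OF S, of k] A B by (intro indep_setD) auto
    then have "emeasure M (A \<inter> ?B) = emeasure M A * emeasure M ?B"
      by (simp add: emeasure_eq_measure ennreal_mult)
    moreover have "emeasure ?D A = emeasure M A"
      using A idm AM by (subst emeasure_distr) (auto simp: Int_absorb2)
    moreover have "emeasure P B = emeasure M ?B"
      using B Sm by (subst distr[symmetric]) (simp add: emeasure_distr)
    moreover have "(\<lambda>\<omega>. (\<omega>, S k \<omega>)) -` (A \<times> B) \<inter> space M = A \<inter> ?B" using AM by auto
    ultimately show "emeasure ?D A * emeasure P B
        = emeasure (distr M (?N \<Otimes>\<^sub>M P) (\<lambda>\<omega>. (\<omega>, S k \<omega>))) (A \<times> B)"
      using A B idm Sm by (subst emeasure_distr) auto
  qed (auto intro: D.sigma_finite_measure_axioms P.sigma_finite_measure_axioms)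
  have "(\<integral>\<^sup>+\<omega>. h (\<omega>, S k \<omega>) \<partial>M) = (\<integral>\<^sup>+z. h z \<partial>distr M (?N \<Otimes>\<^sub>M P) (\<lambda>\<omega>. (\<omega>, S k \<omega>)))"
    using h idm Sm by (subst nn_integral_distr) auto
  also have "\<dots> = (\<integral>\<^sup>+\<omega>. (\<integral>\<^sup>+s. h (\<omega>, s) \<partial>P) \<partial>?D)"
    unfolding eq[symmetric] using h by (subst P.nn_integral_fst[symmetric]) auto
  also have "\<dots> = (\<integral>\<^sup>+\<omega>. (\<integral>\<^sup>+s. h (\<omega>, s) \<partial>P) \<partial>M)"
    using idm h by (subst nn_integral_distr) (auto intro!: P.borel_measurable_nn_integral)
  finally show ?thesis .
qed

section \<open>Local regularity of the loss and of the models\<close>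

text \<open>
  A convex function is continuous in the interior of its domain, and subtracting a quadratic keeps
  this.
\<close>
lemma weakly_convex_isCont:
  fixes h :: "'a::euclidean_space \<Rightarrow> real"
  assumes e: "e > 0" and h: "convex_on (cball x e) (\<lambda>y. h y + c / 2 * (norm (y - x))\<^sup>2)"
  shows "isCont h x"
proof -
  have "convex_on (ball x e) (\<lambda>y. h y + c / 2 * (norm (y - x))\<^sup>2)"
    by (rule convex_on_subset[OF h]) auto
  then have "continuous_on (ball x e) (\<lambda>y. h y + c / 2 * (norm (y - x))\<^sup>2)"
    by (intro convex_on_continuous) auto
  then have "continuous_on (ball x e) (\<lambda>y. (h y + c / 2 * (norm (y - x))\<^sup>2) - c / 2 * (norm (y - x))\<^sup>2)"
    by (rule continuous_on_diff) (intro continuous_intros)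
  then have "continuous_on (ball x e) h" by simp
  then show ?thesis using e by (simp add: continuous_on_eq_continuous_at)
qed

text \<open>
  Weak convexity of the samples integrates, and the weak convexity constant of the mean is the
  expected one.
\<close>
lemma cond_W_mean_loss:
  fixes f :: "'a::euclidean_space \<Rightarrow> 's \<Rightarrow> real"
  assumes W: "cond_W P X f" and int: "\<And>y. integrable P (f y)"
  obtains \<epsilon> where "\<epsilon> > 0"
    and "\<And>x. x \<in> X \<Longrightarrow> \<exists>c. convex_on (cball x \<epsilon>) (\<lambda>y. mean_loss P f y + c / 2 * (norm (y - x))\<^sup>2)"
    and "\<And>x s. x \<in> X \<Longrightarrow> s \<in> space P \<Longrightarrow>
      \<exists>c. convex_on (cball x \<epsilon>) (\<lambda>y. f y s + c / 2 * (norm (y - x))\<^sup>2)"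
proof -
  from W obtain \<epsilon> where \<epsilon>: "\<epsilon> > 0" and *: "\<forall>\<epsilon>'. 0 < \<epsilon>' \<and> \<epsilon>' \<le> \<epsilon> \<longrightarrow> (\<forall>x\<in>X. \<exists>l :: 's \<Rightarrow> real. integrable P l \<and>
      (\<forall>s\<in>space P. 0 \<le> l s \<and> (\<forall>x0. convex_on (cball x \<epsilon>') (\<lambda>y. f y s + l s / 2 * (norm (y - x0))\<^sup>2))))"
    unfolding cond_W_def by (elim exE conjE)
  have W': "\<exists>l :: 's \<Rightarrow> real. integrable P l \<and>
      (\<forall>s\<in>space P. 0 \<le> l s \<and> (\<forall>x0. convex_on (cball x \<epsilon>) (\<lambda>y. f y s + l s / 2 * (norm (y - x0))\<^sup>2)))"
    if "x \<in> X" for x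
    using *[THEN spec, of \<epsilon>, THEN mp] \<epsilon> that by simp
  show thesis
  proof (rule that[OF \<epsilon>])
    fix x s assume x: "x \<in> X" and s: "s \<in> space P"
    obtain l :: "'s \<Rightarrow> real" where "\<forall>s\<in>space P. 0 \<le> l s \<and>
        (\<forall>x0. convex_on (cball x \<epsilon>) (\<lambda>y. f y s + l s / 2 * (norm (y - x0))\<^sup>2))"
      using W'[OF x] by (elim exE conjE)
    from bspec[OF this s]
    show "\<exists>c. convex_on (cball x \<epsilon>) (\<lambda>y. f y s + c / 2 * (norm (y - x))\<^sup>2)"
      by (intro exI[of _ "l s"]) simp
  next
    fix x assume x: "x \<in> X"
    obtain l :: "'s \<Rightarrow> real" where l: "integrable P l"
      and l': "\<forall>s\<in>space P. 0 \<le> l s \<and>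
        (\<forall>x0. convex_on (cball x \<epsilon>) (\<lambda>y. f y s + l s / 2 * (norm (y - x0))\<^sup>2))"
      using W'[OF x] by (elim exE conjE)
    have cv: "convex_on (cball x \<epsilon>) (\<lambda>y. f y s + l s / 2 * (norm (y - x))\<^sup>2)"
      if "s \<in> space P" for s
      using bspec[OF l' that] by simp
    define H where "H y s = f y s + l s / 2 * (norm (y - x))\<^sup>2" for y s
    have Hint: "integrable P (H y)" for y unfolding H_def using int l by auto
    have Heq: "(\<integral>s. H y s \<partial>P) = mean_loss P f y + (\<integral>s. l s \<partial>P) / 2 * (norm (y - x))\<^sup>2" for y
      unfolding H_def mean_loss_def using int l by simp
    have "convex_on (cball x \<epsilon>) (\<lambda>y. \<integral>s. H y s \<partial>P)"
      unfolding convex_on_def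
    proof (intro conjI ballI allI impI convex_cball)
      fix y z and u v :: real
      assume h: "y \<in> cball x \<epsilon>" "z \<in> cball x \<epsilon>" "0 \<le> u" "0 \<le> v" "u + v = 1"
      have "(\<integral>s. H (u *\<^sub>R y + v *\<^sub>R z) s \<partial>P) \<le> (\<integral>s. u * H y s + v * H z s \<partial>P)"
      proof (rule integral_mono)
        fix s assume "s \<in> space P"
        from cv[OF this] h show "H (u *\<^sub>R y + v *\<^sub>R z) s \<le> u * H y s + v * H z s"
          unfolding convex_on_def H_def by blast
      qed (use Hint in auto)
      also have "\<dots> = u * (\<integral>s. H y s \<partial>P) + v * (\<integral>s. H z s \<partial>P)" using Hint by simp
      finally show "(\<integral>s. H (u *\<^sub>R y + v *\<^sub>R z) s \<partial>P) \<le> u * (\<integral>s. H y s \<partial>P) + v * (\<integral>s. H z s \<partial>P)" .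
    qed
    then show "\<exists>c. convex_on (cball x \<epsilon>) (\<lambda>y. mean_loss P f y + c / 2 * (norm (y - x))\<^sup>2)"
      unfolding Heq by (rule exI)
  qed
qed

lemma compact_finite_cover:
  fixes K :: "'a::euclidean_space set"
  assumes "compact K" "0 < \<epsilon>"
  obtains C where "finite C" "C \<subseteq> K" "\<forall>x\<in>K. \<exists>c\<in>C. dist c x < \<epsilon>"
proof -
  have "K \<subseteq> (\<Union>c\<in>K. ball c \<epsilon>)" using assms(2) by auto
  then obtain C where C: "C \<subseteq> K" "finite C" "K \<subseteq> (\<Union>c\<in>C. ball c \<epsilon>)"
    by (rule compactE_image[OF assms(1) open_ball])
  show thesis using C by (intro that) (auto simp: subset_iff)
qed

text \<open>
  The local bounds are available near each point of \<open>X\<close>. The sum of their squares over the centres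
  of a finite cover is integrable and works simultaneously on all of \<open>K\<close>.
\<close>
lemma cond_L_uniform:
  fixes f :: "'a::euclidean_space \<Rightarrow> 's \<Rightarrow> real"
  assumes L: "cond_L P X f" and K: "compact K" "K \<subseteq> X"
  obtains q :: "'s \<Rightarrow> real" where "integrable P q" "\<And>s. 0 \<le> q s"
    and "AE s in P. \<forall>x\<in>K. \<forall>g\<in>frechet_subdiff (\<lambda>z. ereal (f z s)) x. (norm g)\<^sup>2 \<le> q s"
proof -
  from L obtain \<epsilon> where \<epsilon>: "\<epsilon> > 0" and *: "\<forall>\<epsilon>'. 0 < \<epsilon>' \<and> \<epsilon>' \<le> \<epsilon> \<longrightarrow> (\<forall>x\<in>X.
      local_lip X f \<epsilon>' x \<in> borel_measurable P \<and> (\<integral>\<^sup>+s. (local_lip X f \<epsilon>' x s)\<^sup>2 \<partial>P) < \<infinity>)"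
    unfolding cond_L_def by (elim exE conjE)
  have Lm: "local_lip X f \<epsilon> x \<in> borel_measurable P"
    and Li: "(\<integral>\<^sup>+s. (local_lip X f \<epsilon> x s)\<^sup>2 \<partial>P) < \<infinity>" if "x \<in> X" for x
    using *[THEN spec, of \<epsilon>, THEN mp] \<epsilon> that by simp_all
  obtain C where C: "finite C" "C \<subseteq> K" "\<forall>x\<in>K. \<exists>c\<in>C. dist c x < \<epsilon>"
    by (rule compact_finite_cover[OF K(1) \<epsilon>])
  define T where "T s = (\<Sum>c\<in>C. (local_lip X f \<epsilon> c s)\<^sup>2)" for s
  have CX: "c \<in> X" if "c \<in> C" for c using that C K by auto
  have Tm: "T \<in> borel_measurable P"
    unfolding T_def using Lm CX by (intro borel_measurable_sum borel_measurable_power) auto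
  have "(\<integral>\<^sup>+s. T s \<partial>P) = (\<Sum>c\<in>C. \<integral>\<^sup>+s. (local_lip X f \<epsilon> c s)\<^sup>2 \<partial>P)"
    unfolding T_def using Lm CX by (intro nn_integral_sum borel_measurable_power) auto
  also have "\<dots> < \<infinity>" using Li CX C(1) by (simp add: less_top)
  finally have Tfin: "(\<integral>\<^sup>+s. T s \<partial>P) < \<infinity>" .
  then have AEfin: "AE s in P. T s \<noteq> \<infinity>" using Tm by (intro nn_integral_PInf_AE) auto
  show thesis
  proof (rule that[of "\<lambda>s. enn2real (T s)"])
    have "(\<integral>\<^sup>+s. ennreal (norm (enn2real (T s))) \<partial>P) \<le> (\<integral>\<^sup>+s. T s \<partial>P)"
      by (intro nn_integral_mono) (auto simp: ennreal_enn2real_if)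
    then show "integrable P (\<lambda>s. enn2real (T s))"
      using Tm Tfin by (intro integrableI_bounded) auto
    show "AE s in P. \<forall>x\<in>K. \<forall>g\<in>frechet_subdiff (\<lambda>z. ereal (f z s)) x. (norm g)\<^sup>2 \<le> enn2real (T s)"
      using AEfin
    proof (eventually_elim, intro ballI)
      fix s x g assume fin: "T s \<noteq> \<infinity>" and x: "x \<in> K"
        and g: "g \<in> frechet_subdiff (\<lambda>z. ereal (f z s)) x"
      obtain c where c: "c \<in> C" "dist c x < \<epsilon>" using C(3) x by blast
      have "ennreal (norm g) \<le> local_lip X f \<epsilon> c s"
        unfolding local_lip_def using x K c g
        by (intro SUP_upper2[where i = x] SUP_upper2[where i = g]) auto
      then have "(ennreal (norm g))\<^sup>2 \<le> (local_lip X f \<epsilon> c s)\<^sup>2" by (rule power_mono) simp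
      also have "\<dots> \<le> T s"
        unfolding T_def using c C(1) by (intro member_le_sum) auto
      finally have "ennreal ((norm g)\<^sup>2) \<le> T s" by (simp add: ennreal_power)
      then have "enn2real (ennreal ((norm g)\<^sup>2)) \<le> enn2real (T s)"
        using fin by (intro enn2real_mono) (auto simp: less_top)
      then show "(norm g)\<^sup>2 \<le> enn2real (T s)" by simp
    qed
  qed simp
qed

text \<open>
  Here both points must lie in the ball around one centre, so the cover uses half of the radius and
  the other half is left for the distance from \<open>x\<close> to \<open>y\<close>.
\<close>
lemma cond_C4_uniform:
  fixes f :: "'a::euclidean_space \<Rightarrow> 's \<Rightarrow> real"
  assumes C4: "cond_C4 P X f fm" and K: "compact K" "K \<subseteq> X"
  obtains \<epsilon> and \<delta> :: "'s \<Rightarrow> real" where "\<epsilon> > 0" "integrable P \<delta>" "\<And>s. s \<in> space P \<Longrightarrow> 0 \<le> \<delta> s"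
    and "\<And>s x y. s \<in> space P \<Longrightarrow> x \<in> K \<Longrightarrow> norm (y - x) \<le> \<epsilon> \<Longrightarrow>
      fm x y s \<le> ereal (f y s + \<delta> s / 2 * (norm (y - x))\<^sup>2)"
proof -
  from C4 obtain \<epsilon> where \<epsilon>: "\<epsilon> > 0" and *: "\<forall>\<epsilon>'. 0 < \<epsilon>' \<and> \<epsilon>' \<le> \<epsilon> \<longrightarrow> (\<forall>c\<in>X.
      \<exists>\<delta> :: 's \<Rightarrow> real. integrable P \<delta> \<and> (\<forall>s\<in>space P. 0 \<le> \<delta> s \<and>
       (\<forall>x \<in> X \<inter> cball c \<epsilon>'. \<forall>y \<in> cball c \<epsilon>'.
          ereal (f y s) \<ge> fm x y s - ereal (1/2 * \<delta> s * (norm (y - x))\<^sup>2))))"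
    unfolding cond_C4_def by (elim exE conjE)
  have "\<forall>c\<in>X. \<exists>\<delta> :: 's \<Rightarrow> real. integrable P \<delta> \<and> (\<forall>s\<in>space P. 0 \<le> \<delta> s \<and>
       (\<forall>x \<in> X \<inter> cball c \<epsilon>. \<forall>y \<in> cball c \<epsilon>.
          ereal (f y s) \<ge> fm x y s - ereal (1/2 * \<delta> s * (norm (y - x))\<^sup>2)))"
    using *[THEN spec, of \<epsilon>, THEN mp] \<epsilon> by simp
  from bchoice[OF this] obtain D where "\<forall>c\<in>X. integrable P (D c) \<and> (\<forall>s\<in>space P. 0 \<le> D c s \<and>
       (\<forall>x \<in> X \<inter> cball c \<epsilon>. \<forall>y \<in> cball c \<epsilon>.
          ereal (f y s) \<ge> fm x y s - ereal (1/2 * D c s * (norm (y - x))\<^sup>2)))" ..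
  then have D: "c \<in> X \<Longrightarrow> integrable P (D c)"
    "c \<in> X \<Longrightarrow> s \<in> space P \<Longrightarrow> 0 \<le> D c s"
    "c \<in> X \<Longrightarrow> s \<in> space P \<Longrightarrow> x \<in> X \<inter> cball c \<epsilon> \<Longrightarrow> y \<in> cball c \<epsilon> \<Longrightarrow>
        ereal (f y s) \<ge> fm x y s - ereal (1/2 * D c s * (norm (y - x))\<^sup>2)"
    for c s x y by blast+
  obtain C where C: "finite C" "C \<subseteq> K" "\<forall>x\<in>K. \<exists>c\<in>C. dist c x < \<epsilon> / 2"
    by (rule compact_finite_cover[OF K(1), of "\<epsilon> / 2"]) (use \<epsilon> in simp)
  have CX: "c \<in> X" if "c \<in> C" for c using that C K by auto
  show thesis
  proof (rule that[of "\<epsilon> / 2" "\<lambda>s. \<Sum>c\<in>C. D c s"])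
    fix s x y assume s: "s \<in> space P" and x: "x \<in> K" and y: "norm (y - x) \<le> \<epsilon> / 2"
    obtain c where c: "c \<in> C" "dist c x < \<epsilon> / 2" using C(3) x by blast
    have "dist c y \<le> \<epsilon>" using c y dist_triangle[of c y x] by (simp add: dist_norm norm_minus_commute)
    then have "fm x y s - ereal (1/2 * D c s * (norm (y - x))\<^sup>2) \<le> ereal (f y s)"
      using c x K s \<epsilon> CX by (intro D) auto
    then have "fm x y s \<le> ereal (f y s + D c s / 2 * (norm (y - x))\<^sup>2)"
      by (cases "fm x y s") auto
    also have "D c s \<le> (\<Sum>c\<in>C. D c s)"
      using c C(1) D(2)[OF CX s] by (intro member_le_sum) auto
    then have "ereal (f y s + D c s / 2 * (norm (y - x))\<^sup>2)
        \<le> ereal (f y s + (\<Sum>c\<in>C. D c s) / 2 * (norm (y - x))\<^sup>2)"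
      by (simp add: mult_right_mono)
    finally show "fm x y s \<le> ereal (f y s + (\<Sum>c\<in>C. D c s) / 2 * (norm (y - x))\<^sup>2)" .
  qed (use \<epsilon> D CX in \<open>auto intro!: sum_nonneg\<close>)
qed

text \<open>
  The lower bound \<open>low\<close>, with slope \<open>m\<close>, limits how much a step can gain in the model, so the
  quadratic term limits its length. In the second bound the step competes with an arbitrary \<open>y\<close>;
  the possible gain \<open>m * norm (p - x)\<close> and the quadratic term at \<open>p\<close> combine to \<open>a * m\<^sup>2 / 2\<close>.
\<close>
lemma model_step_bounds:
  fixes fm :: "'a::euclidean_space \<Rightarrow> 'a \<Rightarrow> 's \<Rightarrow> ereal" and \<phi> :: "'a \<Rightarrow> real"
  assumes X: "convex X" "x \<in> X" and a: "a > 0" and m: "m \<ge> 0"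
    and cv: "ereal_convex (\<lambda>y. fm x y s)" and \<phi>: "convex_on UNIV \<phi>"
    and center: "fm x x s = ereal fx" and proper: "\<And>y. fm x y s \<noteq> -\<infinity>"
    and p: "is_arg_min (step_objective fm \<phi> a x s) (\<lambda>z. z \<in> X) p"
    and low: "\<And>y b. fm x y s \<le> ereal b \<Longrightarrow> fx + \<phi> x - m * norm (y - x) \<le> b + \<phi> y"
  shows "norm (p - x) \<le> 2 * a * m"
    and "\<And>y b. y \<in> X \<Longrightarrow> fm x y s \<le> ereal b \<Longrightarrow>
      1 / (2 * a) * (norm (y - p))\<^sup>2 \<le> 1 / (2 * a) * (norm (y - x))\<^sup>2 + (b - fx) + (\<phi> y - \<phi> x) + a * m\<^sup>2 / 2"
proof -
  define \<psi> where "\<psi> y = fm x y s + ereal (\<phi> y)" for y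
  have \<psi>: "ereal_convex \<psi>"
    unfolding ereal_convex_def convex_def
  proof (clarsimp)
    fix y t z t' and u v :: real
    assume h: "\<psi> y \<le> ereal t" "\<psi> z \<le> ereal t'" "0 \<le> u" "0 \<le> v" "u + v = 1"
    have "fm x y s \<le> ereal (t - \<phi> y)" "fm x z s \<le> ereal (t' - \<phi> z)"
      using h unfolding \<psi>_def by (cases "fm x y s"; cases "fm x z s"; simp)+
    then have "fm x (y + v *\<^sub>R (z - y)) s \<le> ereal ((1 - v) * (t - \<phi> y) + v * (t' - \<phi> z))"
      using h by (intro ereal_convexD[OF cv]) auto
    moreover have "y + v *\<^sub>R (z - y) = u *\<^sub>R y + v *\<^sub>R z" "1 - v = u"
      using h by (auto simp: algebra_simps simp flip: scaleR_add_left)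
    ultimately have "fm x (u *\<^sub>R y + v *\<^sub>R z) s \<le> ereal (u * (t - \<phi> y) + v * (t' - \<phi> z))" by simp
    moreover have "\<phi> (u *\<^sub>R y + v *\<^sub>R z) \<le> u * \<phi> y + v * \<phi> z"
      using \<phi> h unfolding convex_on_def by blast
    ultimately show "\<psi> (u *\<^sub>R y + v *\<^sub>R z) \<le> ereal (u * t + v * t')"
      unfolding \<psi>_def by (cases "fm x (u *\<^sub>R y + v *\<^sub>R z) s") (auto simp: algebra_simps)
  qed
  have p': "is_arg_min (\<lambda>y. \<psi> y + ereal (1 / (2 * a) * (norm (y - x))\<^sup>2)) (\<lambda>y. y \<in> X) p"
  proof -
    have "step_objective fm \<phi> a x s = (\<lambda>y. \<psi> y + ereal (1 / (2 * a) * (norm (y - x))\<^sup>2))"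
      by (rule ext) (simp add: step_objective_def \<psi>_def add.assoc)
    then show ?thesis using p by simp
  qed
  have "\<psi> p + ereal (1 / (2 * a) * (norm (p - x))\<^sup>2) \<le> \<psi> x + ereal (1 / (2 * a) * (norm (x - x))\<^sup>2)"
    using p' X unfolding is_arg_min_def by (auto simp: not_less)
  then have "\<psi> p + ereal (1 / (2 * a) * (norm (p - x))\<^sup>2) \<le> ereal (fx + \<phi> x)"
    by (simp add: \<psi>_def center)
  then obtain c where c: "fm x p s = ereal c" using proper[of p] by (cases "fm x p s") (auto simp: \<psi>_def)
  then have \<psi>p: "\<psi> p = ereal (c + \<phi> p)" by (simp add: \<psi>_def)
  have lowp: "fx + \<phi> x - m * norm (p - x) \<le> c + \<phi> p" using low[of p c] c by simp
  have "c + \<phi> p + 1 / (2 * a) * (norm (p - x))\<^sup>2 \<le> fx + \<phi> x"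
    using \<open>\<psi> p + _ \<le> ereal (fx + \<phi> x)\<close> \<psi>p by simp
  with lowp have "1 / (2 * a) * (norm (p - x))\<^sup>2 \<le> m * norm (p - x)" by linarith
  then have sq: "(norm (p - x))\<^sup>2 \<le> (2 * a * m) * norm (p - x)" using a by (simp add: field_simps)
  show "norm (p - x) \<le> 2 * a * m"
  proof (cases "p = x")
    case False
    then show ?thesis using sq by (simp add: power2_eq_square)
  next
    case True
    then show ?thesis using a m by simp
  qed
  fix y b assume y: "y \<in> X" "fm x y s \<le> ereal b"
  have "\<psi> y \<le> ereal (b + \<phi> y)" unfolding \<psi>_def using y(2) by (cases "fm x y s") auto
  from prox_three_point[OF \<psi> X(1) a p' \<psi>p y(1) this] lowp
  have "1 / (2 * a) * (norm (y - p))\<^sup>2 \<le> 1 / (2 * a) * (norm (y - x))\<^sup>2 + (b - fx) + (\<phi> y - \<phi> x)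
      + (m * norm (p - x) - 1 / (2 * a) * (norm (p - x))\<^sup>2)" by linarith
  also have "m * norm (p - x) - 1 / (2 * a) * (norm (p - x))\<^sup>2 \<le> a * m\<^sup>2 / 2"
  proof -
    have "0 \<le> (norm (p - x) - a * m)\<^sup>2" by simp
    then show ?thesis using a by (simp add: field_simps power2_eq_square)
  qed
  finally show "1 / (2 * a) * (norm (y - p))\<^sup>2
      \<le> 1 / (2 * a) * (norm (y - x))\<^sup>2 + (b - fx) + (\<phi> y - \<phi> x) + a * m\<^sup>2 / 2" by simp
qed

section \<open>The Moreau envelope over a compact set\<close>

definition moreau_env :: "('a::euclidean_space \<Rightarrow> real) \<Rightarrow> 'a set \<Rightarrow> real \<Rightarrow> 'a \<Rightarrow> real" where
  "moreau_env F K t x = (INF y\<in>K. F y + (norm (y - x))\<^sup>2 / (2 * t))"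

context
  fixes F :: "'a::euclidean_space \<Rightarrow> real" and K :: "'a set" and t :: real
  assumes K: "compact K" "K \<noteq> {}" and F: "continuous_on K F" and t: "t > 0"
begin

lemma moreau_env_attained:
  obtains y where "y \<in> K" "moreau_env F K t x = F y + (norm (y - x))\<^sup>2 / (2 * t)"
    "\<And>z. z \<in> K \<Longrightarrow> moreau_env F K t x \<le> F z + (norm (z - x))\<^sup>2 / (2 * t)"
proof -
  have "continuous_on K (\<lambda>y. F y + (norm (y - x))\<^sup>2 / (2 * t))"
    using t by (intro continuous_intros F) auto
  then obtain y where y: "y \<in> K" "\<forall>z\<in>K. F y + (norm (y - x))\<^sup>2 / (2 * t) \<le> F z + (norm (z - x))\<^sup>2 / (2 * t)"
    using continuous_attains_inf[OF K] by blast
  have "moreau_env F K t x = F y + (norm (y - x))\<^sup>2 / (2 * t)"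
    unfolding moreau_env_def by (rule cInf_eq_minimum) (use y in auto)
  then show thesis using that y by auto
qed

lemma moreau_env_le: "z \<in> K \<Longrightarrow> moreau_env F K t x \<le> F z + (norm (z - x))\<^sup>2 / (2 * t)"
  using moreau_env_attained by metis

text \<open>
  Expanding the square shows that \<open>(norm x)\<^sup>2 / (2 * t)\<close> minus the envelope is a supremum of affine
  functions of \<open>x\<close>, hence convex, hence continuous.
\<close>
lemma continuous_moreau_env: "continuous_on A (moreau_env F K t)"
proof -
  have "convex_on UNIV (\<lambda>x. (norm x)\<^sup>2 / (2 * t) - moreau_env F K t x)"
    unfolding convex_on_def
  proof (intro conjI ballI allI impI convex_UNIV)
    fix x y :: 'a and u v :: real assume uv: "0 \<le> u" "0 \<le> v" "u + v = 1"
    let ?z = "u *\<^sub>R x + v *\<^sub>R y"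
    obtain w where w: "w \<in> K" "moreau_env F K t ?z = F w + (norm (w - ?z))\<^sup>2 / (2 * t)"
      by (rule moreau_env_attained)
    define A where "A x = w \<bullet> x / t - F w - (norm w)\<^sup>2 / (2 * t)" for x
    have A: "(norm x)\<^sup>2 / (2 * t) - (F w + (norm (w - x))\<^sup>2 / (2 * t)) = A x" for x
      unfolding A_def power2_norm_eq_inner using t by (simp add: inner_simps inner_commute field_simps)
    have le: "A x \<le> (norm x)\<^sup>2 / (2 * t) - moreau_env F K t x" for x
      using moreau_env_le[OF w(1), of x] A[of x] by linarith
    have u: "u = 1 - v" using uv by simp
    have "(norm ?z)\<^sup>2 / (2 * t) - moreau_env F K t ?z = A ?z" using w(2) A by simp
    also have "\<dots> = u * A x + v * A y"
      unfolding A_def u using t by (simp add: inner_simps field_simps)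
    also have "\<dots> \<le> u * ((norm x)\<^sup>2 / (2 * t) - moreau_env F K t x) + v * ((norm y)\<^sup>2 / (2 * t) - moreau_env F K t y)"
      using le uv by (intro add_mono mult_left_mono) auto
    finally show "(norm ?z)\<^sup>2 / (2 * t) - moreau_env F K t ?z
       \<le> u * ((norm x)\<^sup>2 / (2 * t) - moreau_env F K t x) + v * ((norm y)\<^sup>2 / (2 * t) - moreau_env F K t y)" .
  qed
  then have "continuous_on UNIV (\<lambda>x. (norm x)\<^sup>2 / (2 * t) - moreau_env F K t x)"
    by (intro convex_on_continuous) auto
  moreover have "continuous_on UNIV (\<lambda>x::'a. (norm x)\<^sup>2 / (2 * t))"
    using t by (intro continuous_intros) auto
  ultimately have "continuous_on UNIV (\<lambda>x. (norm x)\<^sup>2 / (2 * t) - ((norm x)\<^sup>2 / (2 * t) - moreau_env F K t x))"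
    by (rule continuous_on_diff[rotated])
  then have "continuous_on UNIV (moreau_env F K t)" by simp
  then show ?thesis using continuous_on_subset by blast
qed

text \<open>
  A nearly optimal point can be found in a dense sequence. Choosing the first such member gives a
  near minimizer that depends measurably on \<open>x\<close>.
\<close>
lemma moreau_env_near_minimizer:
  assumes d: "range (d :: nat \<Rightarrow> 'a) \<subseteq> K" "K \<subseteq> closure (range d)" and \<eta>: "\<eta> > 0"
  shows "\<exists>j. F (d j) + (norm (d j - x))\<^sup>2 / (2 * t) \<le> moreau_env F K t x + \<eta>"
proof -
  obtain w where w: "w \<in> K" "moreau_env F K t x = F w + (norm (w - x))\<^sup>2 / (2 * t)"
    by (rule moreau_env_attained)
  have "continuous_on K (\<lambda>y. F y + (norm (y - x))\<^sup>2 / (2 * t))"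
    using t by (intro continuous_intros F) auto
  then obtain e where e: "e > 0" "\<And>y. y \<in> K \<Longrightarrow> dist y w < e \<Longrightarrow>
      dist (F y + (norm (y - x))\<^sup>2 / (2 * t)) (F w + (norm (w - x))\<^sup>2 / (2 * t)) < \<eta>"
    using w(1) \<eta> unfolding continuous_on_iff by blast
  obtain j where "dist (d j) w < e"
    using w(1) d(2) e(1) by (auto simp: closure_approachable subset_iff)
  then have "dist (F (d j) + (norm (d j - x))\<^sup>2 / (2 * t)) (F w + (norm (w - x))\<^sup>2 / (2 * t)) < \<eta>"
    using e(2) d(1) by blast
  then show ?thesis using w(2) by (intro exI[of _ j]) (simp add: dist_real_def abs_less_iff)
qed

end

section \<open>Expected descent\<close>

text \<open>
  The events \<open>A k\<close> decrease and belong to the past, so restricting the process to them keeps the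
  inequality between consecutive expectations, and telescoping makes the expected sum of
  \<open>a k * \<Gamma> k\<close> over these events finite. As \<open>\<Gamma> k\<close> is determined by the past and \<open>S k\<close> is independent
  of it, the extra factor \<open>q (S k \<omega>)\<close> only multiplies each expectation by the mean of \<open>q\<close>.
  The function \<open>H k \<omega>\<close> stands for a bound on the next value of \<open>V\<close> as a function of the next sample.
\<close>
lemma (in prob_space) expected_descent_imp_AE_summable:
  fixes V \<Gamma> :: "nat \<Rightarrow> 'a \<Rightarrow> real" and A :: "nat \<Rightarrow> 'a set" and H :: "nat \<Rightarrow> 'a \<Rightarrow> 's \<Rightarrow> real"
    and q :: "'s \<Rightarrow> real"
  assumes P: "prob_space P" and S: "indep_vars (\<lambda>_. P) S UNIV" and distr: "\<And>k. distr M P (S k) = P"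
    and A: "\<And>k. A k \<in> sets (past M P S k)" "\<And>k. A (Suc k) \<subseteq> A k"
    and V: "\<And>k. V k \<in> borel_measurable (past M P S k)" "\<And>k \<omega>. \<omega> \<in> A k \<Longrightarrow> 0 \<le> V k \<omega>"
    and V0: "\<And>\<omega>. \<omega> \<in> A 0 \<Longrightarrow> V 0 \<omega> \<le> b"
    and \<Gamma>: "\<And>k. \<Gamma> k \<in> borel_measurable (past M P S k)" "\<And>k \<omega>. \<omega> \<in> A k \<Longrightarrow> 0 \<le> \<Gamma> k \<omega>"
    and Hm: "\<And>k. (\<lambda>(\<omega>, s). H k \<omega> s) \<in> borel_measurable (past M P S k \<Otimes>\<^sub>M P)"
    and step: "\<And>k. AE \<omega> in M. \<omega> \<in> A k \<longrightarrow> V (Suc k) \<omega> \<le> H k \<omega> (S k \<omega>)"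
    and H0: "\<And>k \<omega>. \<omega> \<in> A k \<Longrightarrow> AE s in P. 0 \<le> H k \<omega> s"
    and Hint: "\<And>k \<omega>. \<omega> \<in> A k \<Longrightarrow> integrable P (H k \<omega>)"
    and descent: "\<And>k \<omega>. \<omega> \<in> A k \<Longrightarrow> (\<integral>s. H k \<omega> s \<partial>P) \<le> V k \<omega> - a k * \<Gamma> k \<omega> + c k"
    and a: "\<And>k. 0 \<le> a k" and c: "\<And>k. 0 \<le> c k" "summable c"
    and q: "integrable P q" "\<And>s. 0 \<le> q s"
  shows "AE \<omega> in M. (\<forall>k. \<omega> \<in> A k) \<longrightarrow> summable (\<lambda>k. a k * \<Gamma> k \<omega> * q (S k \<omega>))"
proof -
  have Sm: "S k \<in> measurable M P" for k using S by (auto simp: indep_vars_def)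
  have lift: "h \<in> measurable M N" if "h \<in> measurable (past M P S k) N" for h k and N :: "'z measure"
    using measurable_compose[OF past_measurable_id[of S P k, OF Sm] that] .
  have AM: "A k \<in> sets M" for k
  proof -
    have "(\<lambda>\<omega>. \<omega>) -` A k \<inter> space M \<in> sets M"
      by (rule measurable_sets[OF past_measurable_id[of S P k, OF Sm] A(1)])
    moreover have "A k \<subseteq> space M" using sets.sets_into_space[OF A(1)] by simp
    ultimately show ?thesis by (simp add: Int_absorb2)
  qed
  have AN [measurable]: "indicator (A k) \<in> borel_measurable (past M P S k)" for k
    using A(1) by simp
  note V(1)[measurable] \<Gamma>(1)[measurable] Hm[measurable]
  have qm [measurable]: "q \<in> borel_measurable P" using q by auto
  have VM: "V k \<in> borel_measurable M" and \<Gamma>M: "\<Gamma> k \<in> borel_measurable M"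
    and iM: "(indicator (A k) :: 'a \<Rightarrow> ennreal) \<in> borel_measurable M" for k
    by (rule lift[OF V(1)], rule lift[OF \<Gamma>(1)], rule borel_measurable_indicator[OF AM])
  define v where "v k = (\<integral>\<^sup>+\<omega>. indicator (A k) \<omega> * ennreal (V k \<omega>) \<partial>M)" for k
  define g where "g k = (\<integral>\<^sup>+\<omega>. indicator (A k) \<omega> * ennreal (\<Gamma> k \<omega>) \<partial>M)" for k
  have one: "v (Suc k) + ennreal (a k) * g k \<le> v k + ennreal (c k)" for k
  proof -
    have "v (Suc k) \<le> (\<integral>\<^sup>+\<omega>. indicator (A k) \<omega> * ennreal (H k \<omega> (S k \<omega>)) \<partial>M)"
      unfolding v_def
    proof (rule nn_integral_mono_AE, use step[of k] in eventually_elim)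
      fix \<omega> assume "\<omega> \<in> A k \<longrightarrow> V (Suc k) \<omega> \<le> H k \<omega> (S k \<omega>)"
      then show "indicator (A (Suc k)) \<omega> * ennreal (V (Suc k) \<omega>)
          \<le> indicator (A k) \<omega> * ennreal (H k \<omega> (S k \<omega>))"
        using A(2)[of k] by (auto simp: indicator_def intro!: ennreal_leI)
    qed
    also have "\<dots> = (\<integral>\<^sup>+\<omega>. (\<integral>\<^sup>+s. indicator (A k) \<omega> * ennreal (H k \<omega> s) \<partial>P) \<partial>M)"
    proof -
      have "(\<lambda>(\<omega>, s). indicator (A k) \<omega> * ennreal (H k \<omega> s)) \<in> borel_measurable (past M P S k \<Otimes>\<^sub>M P)"
        by measurable
      from nn_integral_past_fresh[OF S distr P this] show ?thesis by simp
    qed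
    also have "\<dots> \<le> (\<integral>\<^sup>+\<omega>. indicator (A k) \<omega> * ennreal (V k \<omega> - a k * \<Gamma> k \<omega> + c k) \<partial>M)"
    proof (rule nn_integral_mono)
      fix \<omega> assume "\<omega> \<in> space M"
      show "(\<integral>\<^sup>+s. indicator (A k) \<omega> * ennreal (H k \<omega> s) \<partial>P)
          \<le> indicator (A k) \<omega> * ennreal (V k \<omega> - a k * \<Gamma> k \<omega> + c k)"
      proof (cases "\<omega> \<in> A k")
        case True
        have "(\<integral>\<^sup>+s. ennreal (H k \<omega> s) \<partial>P) = ennreal (\<integral>s. H k \<omega> s \<partial>P)"
          using Hint[OF True] H0[OF True] by (rule nn_integral_eq_integral)
        also have "\<dots> \<le> ennreal (V k \<omega> - a k * \<Gamma> k \<omega> + c k)"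
          using descent[OF True] by (rule ennreal_leI)
        finally show ?thesis using True by simp
      qed simp
    qed
    finally have "v (Suc k) + ennreal (a k) * g k
      \<le> (\<integral>\<^sup>+\<omega>. indicator (A k) \<omega> * ennreal (V k \<omega> - a k * \<Gamma> k \<omega> + c k) \<partial>M) + ennreal (a k) * g k"
      by (rule add_right_mono)
    also have "\<dots> = (\<integral>\<^sup>+\<omega>. indicator (A k) \<omega> * ennreal (V k \<omega> - a k * \<Gamma> k \<omega> + c k)
        + ennreal (a k) * (indicator (A k) \<omega> * ennreal (\<Gamma> k \<omega>)) \<partial>M)"
      unfolding g_def using VM \<Gamma>M iM
      by (subst nn_integral_cmult[symmetric]) (auto intro!: nn_integral_add[symmetric])
    also have "\<dots> \<le> (\<integral>\<^sup>+\<omega>. indicator (A k) \<omega> * ennreal (V k \<omega>) + ennreal (c k) \<partial>M)"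
    proof (rule nn_integral_mono)
      fix \<omega> assume "\<omega> \<in> space M"
      show "indicator (A k) \<omega> * ennreal (V k \<omega> - a k * \<Gamma> k \<omega> + c k)
        + ennreal (a k) * (indicator (A k) \<omega> * ennreal (\<Gamma> k \<omega>))
        \<le> indicator (A k) \<omega> * ennreal (V k \<omega>) + ennreal (c k)"
      proof (cases "\<omega> \<in> A k")
        case True
        have "0 \<le> (\<integral>s. H k \<omega> s \<partial>P)" using H0[OF True] by (rule integral_nonneg_AE)
        then have "0 \<le> V k \<omega> - a k * \<Gamma> k \<omega> + c k" using descent[OF True] by linarith
        moreover have "0 \<le> a k * \<Gamma> k \<omega>" using a \<Gamma>(2)[OF True] by simp
        ultimately have "ennreal (V k \<omega> - a k * \<Gamma> k \<omega> + c k) + ennreal (a k * \<Gamma> k \<omega>)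
            = ennreal (V k \<omega> + c k)"
          by (simp flip: ennreal_plus)
        then show ?thesis
          using True a \<Gamma>(2)[OF True] V(2)[OF True] c(1) by (simp add: ennreal_mult)
      qed simp
    qed
    also have "\<dots> = v k + ennreal (c k)"
      unfolding v_def using VM iM by (subst nn_integral_add) (auto simp: emeasure_space_1)
    finally show ?thesis .
  qed
  have tel: "v n + (\<Sum>k<n. ennreal (a k) * g k) \<le> v 0 + (\<Sum>k<n. ennreal (c k))" for n
  proof (induction n)
    case (Suc n)
    have "v (Suc n) + (\<Sum>k<Suc n. ennreal (a k) * g k)
        = (v (Suc n) + ennreal (a n) * g n) + (\<Sum>k<n. ennreal (a k) * g k)" by (simp add: ac_simps)
    also have "\<dots> \<le> (v n + ennreal (c n)) + (\<Sum>k<n. ennreal (a k) * g k)"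
      by (rule add_right_mono[OF one])
    also have "\<dots> = (v n + (\<Sum>k<n. ennreal (a k) * g k)) + ennreal (c n)" by (simp add: ac_simps)
    also have "\<dots> \<le> (v 0 + (\<Sum>k<n. ennreal (c k))) + ennreal (c n)"
      by (rule add_right_mono[OF Suc.IH])
    finally show ?case by (simp add: ac_simps)
  qed simp
  have "v 0 \<le> (\<integral>\<^sup>+\<omega>. ennreal b \<partial>M)"
    unfolding v_def using V0 by (intro nn_integral_mono) (auto simp: indicator_def intro: ennreal_leI)
  then have v0: "v 0 \<le> ennreal b" by (simp add: emeasure_space_1)
  have "(\<Sum>k. ennreal (a k) * g k) \<le> ennreal b + ennreal (suminf c)"
  proof (rule suminf_le_const[OF summableI])
    fix n
    have "(\<Sum>k<n. ennreal (c k)) \<le> ennreal (suminf c)"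
      using c by (subst sum_ennreal) (auto intro!: ennreal_leI sum_le_suminf)
    then have "v 0 + (\<Sum>k<n. ennreal (c k)) \<le> ennreal b + ennreal (suminf c)"
      using v0 by (intro add_mono)
    then show "(\<Sum>k<n. ennreal (a k) * g k) \<le> ennreal b + ennreal (suminf c)"
      using tel[of n] by (meson add_increasing order_trans zero_le order_refl)
  qed
  then have fin: "(\<Sum>k. ennreal (a k) * g k) < \<infinity>" by (rule le_less_trans) simp
  define W where "W k \<omega> = indicator (A k) \<omega> * ennreal (a k * \<Gamma> k \<omega> * q (S k \<omega>))" for k \<omega>
  have WM: "W k \<in> borel_measurable M" for k
    unfolding W_def using \<Gamma>M iM measurable_compose[OF Sm qm] by measurable
  have Weq: "(\<integral>\<^sup>+\<omega>. W k \<omega> \<partial>M) = ennreal (a k) * g k * ennreal (\<integral>s. q s \<partial>P)" for k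
  proof -
    have "(\<lambda>(\<omega>, s). indicator (A k) \<omega> * ennreal (a k * \<Gamma> k \<omega> * q s)) \<in> borel_measurable (past M P S k \<Otimes>\<^sub>M P)"
      by measurable
    from nn_integral_past_fresh[OF S distr P this]
    have "(\<integral>\<^sup>+\<omega>. W k \<omega> \<partial>M) = (\<integral>\<^sup>+\<omega>. (\<integral>\<^sup>+s. indicator (A k) \<omega> * ennreal (a k * \<Gamma> k \<omega> * q s) \<partial>P) \<partial>M)"
      by (simp add: W_def)
    also have "\<dots> = (\<integral>\<^sup>+\<omega>. (ennreal (a k) * (indicator (A k) \<omega> * ennreal (\<Gamma> k \<omega>))) * ennreal (\<integral>s. q s \<partial>P) \<partial>M)"
    proof (rule nn_integral_cong)
      fix \<omega>
      show "(\<integral>\<^sup>+s. indicator (A k) \<omega> * ennreal (a k * \<Gamma> k \<omega> * q s) \<partial>P)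
        = (ennreal (a k) * (indicator (A k) \<omega> * ennreal (\<Gamma> k \<omega>))) * ennreal (\<integral>s. q s \<partial>P)"
      proof (cases "\<omega> \<in> A k")
        case True
        then show ?thesis
          using a q \<Gamma>(2)[OF True] nn_integral_eq_integral[OF q(1)]
          by (simp add: ennreal_mult nn_integral_cmult)
      qed simp
    qed
    also have "\<dots> = ennreal (a k) * g k * ennreal (\<integral>s. q s \<partial>P)"
      unfolding g_def using \<Gamma>M iM by (simp add: nn_integral_cmult nn_integral_multc)
    finally show ?thesis .
  qed
  have "(\<integral>\<^sup>+\<omega>. (\<Sum>k. W k \<omega>) \<partial>M) = (\<Sum>k. ennreal (a k) * g k) * ennreal (\<integral>s. q s \<partial>P)"
    using WM by (simp add: nn_integral_suminf Weq ennreal_suminf_multc)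
  also have "\<dots> < \<infinity>" using fin by (simp add: ennreal_mult_less_top)
  finally have "AE \<omega> in M. (\<Sum>k. W k \<omega>) \<noteq> \<infinity>" using WM by (intro nn_integral_PInf_AE) auto
  then show ?thesis
  proof (eventually_elim, intro impI)
    fix \<omega> assume h: "(\<Sum>k. W k \<omega>) \<noteq> \<infinity>" and all: "\<forall>k. \<omega> \<in> A k"
    then have "(\<Sum>k. ennreal (a k * \<Gamma> k \<omega> * q (S k \<omega>))) \<noteq> top" by (simp add: W_def)
    then show "summable (\<lambda>k. a k * \<Gamma> k \<omega> * q (S k \<omega>))"
      using a \<Gamma>(2) q all by (intro summable_suminf_not_top) auto
  qed
qed

lemma AE_distr_eq:
  assumes "T \<in> measurable M P" "distr M P T = P" "AE s in P. Q s"
  shows "AE \<omega> in M. Q (T \<omega>)"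
  by (rule AE_distrD[OF assms(1)]) (subst assms(2), rule assms(3))

lemma AE_summable_sample:
  fixes q :: "'s \<Rightarrow> real"
  assumes S: "\<And>k. S k \<in> measurable M P" "\<And>k. distr M P (S k) = P"
    and q: "integrable P q" "\<And>s. 0 \<le> q s" and b: "summable b" "\<And>k. 0 \<le> b k"
  shows "AE \<omega> in M. summable (\<lambda>k. b k * q (S k \<omega>))"
proof -
  have qm: "q \<in> borel_measurable P" using q by auto
  have Wm: "(\<lambda>\<omega>. ennreal (b k * q (S k \<omega>))) \<in> borel_measurable M" for k
    using measurable_compose[OF S(1) qm] by measurable
  have "(\<integral>\<^sup>+\<omega>. ennreal (b k * q (S k \<omega>)) \<partial>M) = ennreal (b k * (\<integral>s. q s \<partial>P))" for k
  proof -
    have "(\<integral>\<^sup>+\<omega>. ennreal (b k * q (S k \<omega>)) \<partial>M) = (\<integral>\<^sup>+s. ennreal (b k * q s) \<partial>distr M P (S k))"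
      using S qm by (subst nn_integral_distr) auto
    also have "\<dots> = ennreal (\<integral>s. b k * q s \<partial>P)"
      unfolding S(2) using q b by (intro nn_integral_eq_integral) auto
    finally show ?thesis by simp
  qed
  then have "(\<integral>\<^sup>+\<omega>. (\<Sum>k. ennreal (b k * q (S k \<omega>))) \<partial>M) = (\<Sum>k. ennreal (b k * (\<integral>s. q s \<partial>P)))"
    using Wm by (simp add: nn_integral_suminf)
  also have "\<dots> = ennreal (\<Sum>k. b k * (\<integral>s. q s \<partial>P))"
    using b q by (intro suminf_ennreal2 summable_mult2 mult_nonneg_nonneg) (auto intro: integral_nonneg_AE)
  also have "\<dots> < \<infinity>" by simp
  finally have "AE \<omega> in M. (\<Sum>k. ennreal (b k * q (S k \<omega>))) \<noteq> \<infinity>"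
    using Wm by (intro nn_integral_PInf_AE) auto
  then show ?thesis
  proof eventually_elim
    fix \<omega> assume "(\<Sum>k. ennreal (b k * q (S k \<omega>))) \<noteq> \<infinity>"
    then show "summable (\<lambda>k. b k * q (S k \<omega>))" using b q by (intro summable_suminf_not_top) auto
  qed
qed

section \<open>The model-based method\<close>

locale model_based_method = prob_space \<Omega>
  for \<Omega> :: "'w measure" +
  fixes P :: "'s measure" and X :: "'a::euclidean_space set"
    and f :: "'a \<Rightarrow> 's \<Rightarrow> real" and \<phi> :: "'a \<Rightarrow> real"
    and fm :: "'a \<Rightarrow> 'a \<Rightarrow> 's \<Rightarrow> ereal"
    and S :: "nat \<Rightarrow> 'w \<Rightarrow> 's" and x :: "nat \<Rightarrow> 'w \<Rightarrow> 'a" and \<alpha> :: "nat \<Rightarrow> real"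
  assumes P: "prob_space P"
    and S_indep: "indep_vars (\<lambda>_. P) S UNIV" and S_distr: "\<And>k. distr \<Omega> P (S k) = P"
    and X: "closed X" "convex X" and \<phi>: "convex_on UNIV \<phi>"
    and f_int: "\<And>y. integrable P (\<lambda>s. f y s)"
    and fm_proper: "\<And>y z s. y \<in> X \<Longrightarrow> s \<in> space P \<Longrightarrow> fm y z s \<noteq> -\<infinity>"
    and C: "cond_C1 P X fm" "cond_C2 P X f fm" "cond_C3 P X f fm" "cond_C4 P X f fm"
    and L: "cond_L P X f" and W: "cond_W P X f"
    and \<alpha>_pos: "\<And>k. \<alpha> k > 0"
    and \<alpha>_sum: "\<not> summable \<alpha>" "summable (\<lambda>k. (\<alpha> k)\<^sup>2)"
    and attained: "\<And>k y s. y \<in> X \<Longrightarrow> s \<in> space P \<Longrightarrow>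
      \<exists>z. is_arg_min (step_objective fm \<phi> (\<alpha> k) y s) (\<lambda>z. z \<in> X) z"
    and x_0: "\<And>\<omega>. \<omega> \<in> space \<Omega> \<Longrightarrow> x 0 \<omega> \<in> X"
    and x_step: "\<And>k \<omega>. \<omega> \<in> space \<Omega> \<Longrightarrow>
      x (Suc k) \<omega> = arg_min (step_objective fm \<phi> (\<alpha> k) (x k \<omega>) (S k \<omega>)) (\<lambda>z. z \<in> X)"
    and x_meas: "\<And>k. x k \<in> borel_measurable (past \<Omega> P S k)"
begin

lemma S_measurable: "S k \<in> measurable \<Omega> P"
  using S_indep by (auto simp: indep_vars_def)

lemma S_space: "\<omega> \<in> space \<Omega> \<Longrightarrow> S k \<omega> \<in> space P"
  by (rule measurable_space[OF S_measurable])

lemma iterate_in_X: "\<omega> \<in> space \<Omega> \<Longrightarrow> x k \<omega> \<in> X"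
proof (induction k)
  case (Suc k)
  from attained[OF Suc.IH[OF Suc.prems] S_space[OF Suc.prems]]
  have "is_arg_min (step_objective fm \<phi> (\<alpha> k) (x k \<omega>) (S k \<omega>)) (\<lambda>z. z \<in> X) (x (Suc k) \<omega>)"
    unfolding x_step[OF Suc.prems] arg_min_def by (rule someI_ex)
  then show ?case by (simp add: is_arg_min_def)
qed (rule x_0)

lemma iterate_is_arg_min:
  assumes "\<omega> \<in> space \<Omega>"
  shows "is_arg_min (step_objective fm \<phi> (\<alpha> k) (x k \<omega>) (S k \<omega>)) (\<lambda>z. z \<in> X) (x (Suc k) \<omega>)"
  unfolding x_step[OF assms] arg_min_def
  by (rule someI_ex[OF attained[OF iterate_in_X[OF assms] S_space[OF assms]]])

lemma continuous_\<phi>: "continuous_on A \<phi>"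
  using convex_on_continuous[OF open_UNIV \<phi>] continuous_on_subset by blast

lemma continuous_loss: "s \<in> space P \<Longrightarrow> continuous_on X (\<lambda>y. f y s)"
proof (rule continuous_at_imp_continuous_on, intro ballI)
  fix y assume s: "s \<in> space P" and y: "y \<in> X"
  obtain \<epsilon> c where "\<epsilon> > 0" "convex_on (cball y \<epsilon>) (\<lambda>z. f z s + c / 2 * (norm (z - y))\<^sup>2)"
    using s y by (metis cond_W_mean_loss[OF W f_int])
  then show "isCont (\<lambda>y. f y s) y" by (rule weakly_convex_isCont)
qed

lemma continuous_objective: "continuous_on X (objective P f \<phi>)"
proof -
  have "isCont (mean_loss P f) y" if y: "y \<in> X" for y
  proof -
    obtain \<epsilon> c where "\<epsilon> > 0" "convex_on (cball y \<epsilon>) (\<lambda>z. mean_loss P f z + c / 2 * (norm (z - y))\<^sup>2)"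
      using y by (metis cond_W_mean_loss[OF W f_int])
    then show ?thesis by (rule weakly_convex_isCont)
  qed
  then have "continuous_on X (mean_loss P f)"
    by (intro continuous_at_imp_continuous_on) auto
  then show ?thesis
    unfolding objective_def by (intro continuous_on_add continuous_\<phi>)
qed

text \<open>
  A point at which the Moreau envelope equals the objective minimizes the objective plus a
  quadratic centred at the point itself, and the quadratic has no first-order effect there.
\<close>
lemma envelope_fixed_point_stationary:
  assumes z: "z \<in> X" and e: "e > 0"
    and min: "\<And>y. y \<in> X \<inter> cball z e \<Longrightarrow> objective P f \<phi> z \<le> objective P f \<phi> y + (norm (y - z))\<^sup>2 / (2 * t)"
  shows "z \<in> stationary_set P X f \<phi>"
proof -
  obtain \<epsilon> c where \<epsilon>: "\<epsilon> > 0"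
    and cv: "convex_on (cball z \<epsilon>) (\<lambda>y. mean_loss P f y + c / 2 * (norm (y - z))\<^sup>2)"
    using z by (metis cond_W_mean_loss[OF W f_int])
  define e' where "e' = min e \<epsilon>"
  have "\<exists>u \<in> frechet_subdiff (\<lambda>y. ereal (mean_loss P f y)) z. \<exists>v \<in> frechet_subdiff (\<lambda>y. ereal (\<phi> y)) z.
    \<forall>y\<in>X. (u + v) \<bullet> (y - z) \<ge> 0"
  proof (rule weakly_convex_minimizer_stationary[OF X(2) z \<phi>])
    show "e' > 0" using e \<epsilon> by (simp add: e'_def)
    show "convex_on (cball z e') (\<lambda>y. mean_loss P f y + c / 2 * (norm (y - z))\<^sup>2)"
      by (rule convex_on_subset[OF cv]) (auto simp: e'_def)
    fix y assume "y \<in> X \<inter> cball z e'"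
    then show "mean_loss P f z + \<phi> z \<le> mean_loss P f y + \<phi> y + (1 / t) / 2 * (norm (y - z))\<^sup>2"
      using min[of y] by (simp add: objective_def e'_def mult.commute)
  qed
  then show ?thesis using z by (simp add: stationary_set_def)
qed

text \<open>
  Restricted to runs inside a fixed ball, all constants of the assumptions become uniform.
  The envelope is taken over the ball of radius \<open>R + 1\<close>, so that a point of the smaller ball with
  vanishing gap is a minimizer over a full neighbourhood in \<open>X\<close> and the artificial
  constraint leaves no trace in the stationarity condition.
\<close>
lemma AE_bounded_run:
  "AE \<omega> in \<Omega>. (\<forall>k. norm (x k \<omega>) \<le> R) \<longrightarrow>
     (\<lambda>k. dist (x (Suc k) \<omega>) (x k \<omega>)) \<longlonglongrightarrow> 0 \<and>
     (\<forall>r z. strict_mono (r :: nat \<Rightarrow> nat) \<longrightarrow> (\<lambda>k. x (r k) \<omega>) \<longlonglongrightarrow> z \<longrightarrow> z \<in> stationary_set P X f \<phi>)"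
proof (cases "X \<inter> cball 0 R = {}")
  case True
  then have "\<not> (\<forall>k. norm (x k \<omega>) \<le> R)" if "\<omega> \<in> space \<Omega>" for \<omega>
    using iterate_in_X[OF that, of 0] by force
  then show ?thesis by (intro AE_I2) blast
next
  case False
  interpret P: prob_space P by (rule P)
  define F where "F = objective P f \<phi>"
  define K where "K = X \<inter> cball 0 R"
  define K' where "K' = X \<inter> cball 0 (R + 1)"
  have K: "compact K" "K \<subseteq> X" "K \<noteq> {}"
    using False X(1) by (auto simp: K_def closed_Int_compact)
  have K': "compact K'" "K' \<subseteq> X" "K \<subseteq> K'" "K' \<noteq> {}"
    using False X(1) by (auto simp: K_def K'_def closed_Int_compact)
  have FX: "continuous_on X F" unfolding F_def by (rule continuous_objective)
  have FK': "continuous_on K' F" using FX K'(2) continuous_on_subset by blast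
  obtain b where b: "b > 0" "\<And>y. y \<in> K' \<Longrightarrow> \<bar>F y\<bar> \<le> b"
    using compact_imp_bounded[OF compact_continuous_image[OF FK' K'(1)]]
    unfolding bounded_pos by auto
  obtain B where B: "B > 0" "\<And>y. norm y \<le> R + 1 \<Longrightarrow> \<bar>\<phi> y\<bar> \<le> B"
    using compact_imp_bounded[OF compact_continuous_image[OF continuous_\<phi> compact_cball[of 0 "R + 1"]]]
    unfolding bounded_pos by auto
  obtain \<epsilon> \<delta> where \<epsilon>: "\<epsilon> > 0" and \<delta>: "integrable P \<delta>" "\<And>s. s \<in> space P \<Longrightarrow> 0 \<le> \<delta> s"
    and upper: "\<And>s y z. s \<in> space P \<Longrightarrow> y \<in> K \<Longrightarrow> norm (z - y) \<le> \<epsilon> \<Longrightarrow>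
      fm y z s \<le> ereal (f z s + \<delta> s / 2 * (norm (z - y))\<^sup>2)"
    using cond_C4_uniform[OF C(4) K(1,2)] by blast
  obtain q0 where q0: "integrable P q0" "\<And>s. 0 \<le> q0 s"
    and sub: "AE s in P. \<forall>y\<in>K. \<forall>g\<in>frechet_subdiff (\<lambda>z. ereal (f z s)) y. (norm g)\<^sup>2 \<le> q0 s"
    using cond_L_uniform[OF L K(1,2)] by blast
  \<comment> \<open>\<open>2 * B\<close> is a slope for \<open>\<phi>\<close>, and \<open>q\<close> dominates the square of the sum of the slopes of loss
    and \<open>\<phi>\<close>, by \<open>(u + v)\<^sup>2 \<le> 2 * u\<^sup>2 + 2 * v\<^sup>2\<close>\<close>
  define q where "q s = 2 * q0 s + 8 * B\<^sup>2" for s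
  have q: "integrable P q" "\<And>s. 0 \<le> q s" unfolding q_def[abs_def] using q0 by auto
  define good where "good s \<longleftrightarrow> s \<in> space P \<and>
     (\<forall>y\<in>K. \<forall>g\<in>frechet_subdiff (\<lambda>z. ereal (f z s)) y. (norm g)\<^sup>2 \<le> q0 s)" for s
  have AEgood: "AE s in P. good s" using sub by (auto simp: good_def)
  have low: "f y s + \<phi> y - sqrt (q s) * norm (z - y) \<le> c + \<phi> z"
    if s: "good s" and y: "y \<in> K" and z: "fm y z s \<le> ereal c" for y z s c
  proof -
    have sP: "s \<in> space P" and yX: "y \<in> X" using s y K by (auto simp: good_def)
    have fy: "fm y y s = ereal (f y s)" using C(2) yX sP by (simp add: cond_C2_def)
    have cv: "ereal_convex (\<lambda>z. fm y z s)"
      and ne: "frechet_subdiff (\<lambda>z. fm y z s) y \<noteq> {}"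
      using C(1) yX sP fy by (auto simp: cond_C1_def)
    then obtain g where g: "g \<in> frechet_subdiff (\<lambda>z. fm y z s) y" by blast
    then have "g \<in> frechet_subdiff (\<lambda>z. ereal (f z s)) y"
      using C(3) yX sP by (auto simp: cond_C3_def)
    then have gq: "(norm g)\<^sup>2 \<le> q0 s" using s y by (auto simp: good_def)
    have "f y s + g \<bullet> (z - y) \<le> c" by (rule frechet_subdiff_convex_minorant[OF cv g fy z])
    moreover have "- (norm g * norm (z - y)) \<le> g \<bullet> (z - y)"
      using Cauchy_Schwarz_ineq2[of g "z - y"] by linarith
    moreover have "\<phi> y - 2 * B * norm (z - y) \<le> \<phi> z"
      using y by (intro convex_on_lower_lipschitz[OF \<phi> B(2)]) (auto simp: K_def)
    moreover have "norm g + 2 * B \<le> sqrt (q s)"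
    proof (rule real_le_rsqrt)
      have "0 \<le> (norm g - 2 * B)\<^sup>2" by simp
      then show "(norm g + 2 * B)\<^sup>2 \<le> q s"
        using gq by (simp add: q_def power2_eq_square algebra_simps)
    qed
    then have "(norm g + 2 * B) * norm (z - y) \<le> sqrt (q s) * norm (z - y)"
      by (rule mult_right_mono) simp
    ultimately show ?thesis by (simp add: distrib_right)
  qed
  define \<Delta> where "\<Delta> = (\<integral>s. \<delta> s \<partial>P)"
  have \<Delta>: "\<Delta> \<ge> 0" unfolding \<Delta>_def using \<delta>(2) by (intro integral_nonneg_AE) auto
  \<comment> \<open>The first bound lets the proximal term absorb the model error \<open>\<Delta>\<close>; the second keeps near
    minimizers within distance \<open>\<epsilon>\<close> of their centre, where the models are controlled.\<close>
  define t where "t = min (1 / (\<Delta> + 1)) (\<epsilon>\<^sup>2 / (4 * b + 2))"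
  have t: "t > 0" using \<Delta> \<epsilon> b by (simp add: t_def)
  have t\<Delta>: "\<Delta> \<le> 1 / t"
  proof -
    have "t \<le> 1 / (\<Delta> + 1)" by (simp add: t_def)
    then have "\<Delta> + 1 \<le> 1 / t" using t \<Delta> by (simp add: field_simps)
    then show ?thesis by simp
  qed
  have t\<epsilon>: "2 * t * (2 * b + 1) \<le> \<epsilon>\<^sup>2"
  proof -
    have "t \<le> \<epsilon>\<^sup>2 / (4 * b + 2)" by (simp add: t_def)
    then show ?thesis using b by (simp add: field_simps)
  qed
  define e where "e = moreau_env F K' t"
  have e_le: "e y \<le> F z + (norm (z - y))\<^sup>2 / (2 * t)" if "z \<in> K'" for y z
    unfolding e_def by (rule moreau_env_le[OF K'(1,4) FK' t that])
  have e_ge: "- b \<le> e y" for y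
  proof -
    obtain w where "w \<in> K'" "e y = F w + (norm (w - y))\<^sup>2 / (2 * t)"
      unfolding e_def by (rule moreau_env_attained[OF K'(1,4) FK' t])
    then show ?thesis using b(2)[of w] t by (simp add: abs_le_iff add_increasing2)
  qed
  have e_cont: "continuous_on A e" for A
    unfolding e_def by (rule continuous_moreau_env[OF K'(1,4) FK' t])
  define G where "G y = F y - e y" for y
  have G0: "0 \<le> G y" if "y \<in> K'" for y using e_le[OF that, of y] by (simp add: G_def)
  obtain d :: "nat \<Rightarrow> 'a" where d: "range d \<subseteq> K'" "K' \<subseteq> closure (range d)"
    by (rule dense_seq_ex[OF K'(4)])
  \<comment> \<open>an admissible loss of optimality that is summable, also after multiplication with \<open>\<alpha> k\<close>\<close>
  define \<eta> where "\<eta> k = min 1 (min (\<alpha> k) ((\<alpha> k)\<^sup>2))" for k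
  have \<eta>: "\<eta> k > 0" "\<eta> k \<le> 1" "\<eta> k \<le> \<alpha> k" "\<eta> k \<le> (\<alpha> k)\<^sup>2" for k
    using \<alpha>_pos[of k] by (auto simp: \<eta>_def)
  define j where "j k y = (LEAST j. F (d j) + (norm (d j - y))\<^sup>2 / (2 * t) \<le> e y + \<eta> k)" for k y
  define w where "w k y = d (j k y)" for k y
  have w_near: "F (w k y) + (norm (w k y - y))\<^sup>2 / (2 * t) \<le> e y + \<eta> k" for k y
    unfolding w_def j_def e_def
    by (rule LeastI_ex) (rule moreau_env_near_minimizer[OF K'(1,4) FK' t d \<eta>(1)])
  have wK: "w k y \<in> K'" for k y using d(1) by (auto simp: w_def)
  have w_eps: "norm (w k y - y) \<le> \<epsilon>" if y: "y \<in> K" for k y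
  proof -
    have "y \<in> K'" using y K' by auto
    from e_le[OF this, of y] have "e y \<le> b" using b(2)[OF \<open>y \<in> K'\<close>] by simp
    then have "(norm (w k y - y))\<^sup>2 / (2 * t) \<le> 2 * b + 1"
      using w_near[of k y] b(2)[OF wK[of k y]] \<eta>(2)[of k] by linarith
    then have "(norm (w k y - y))\<^sup>2 \<le> 2 * t * (2 * b + 1)" using t by (simp add: field_simps)
    then have "(norm (w k y - y))\<^sup>2 \<le> \<epsilon>\<^sup>2" using t\<epsilon> by linarith
    then show ?thesis using \<epsilon> by (simp add: power2_le_iff_abs_le)
  qed
  \<comment> \<open>The summand \<open>b\<close> makes the envelope nonnegative. The rest is the envelope at \<open>w k y\<close> after one
    step from \<open>y\<close> with sample \<open>s\<close>, as estimated by the three-point inequality.\<close>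
  define H where "H k y s = b + e y + \<eta> k + \<alpha> k / t * (f (w k y) s - f y s + \<phi> (w k y) - \<phi> y
      + \<delta> s / 2 * (norm (w k y - y))\<^sup>2) + (\<alpha> k)\<^sup>2 * q s / (2 * t)" for k y s
  \<comment> \<open>The value of the envelope at the new point \<open>p\<close> is at most that of the candidate \<open>w k y\<close>,
    whose distance to \<open>p\<close> is controlled by the step.\<close>
  have step: "norm (p - y) \<le> 2 * \<alpha> k * sqrt (q s)" "b + e p \<le> H k y s"
    if s: "good s" and y: "y \<in> K" and p: "is_arg_min (step_objective fm \<phi> (\<alpha> k) y s) (\<lambda>z. z \<in> X) p"
    for k y s p
  proof -
    have sP: "s \<in> space P" and yX: "y \<in> X" using s y K by (auto simp: good_def)
    have fy: "fm y y s = ereal (f y s)" using C(2) yX sP by (simp add: cond_C2_def)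
    have cv: "ereal_convex (\<lambda>z. fm y z s)" using C(1) yX sP by (auto simp: cond_C1_def)
    have m: "0 \<le> sqrt (q s)" using q(2) by simp
    note bounds = model_step_bounds[where fm = fm, OF X(2) yX \<alpha>_pos m cv \<phi> fy fm_proper[OF yX sP] p low[OF s y]]
    show "norm (p - y) \<le> 2 * \<alpha> k * sqrt (q s)" by (rule bounds(1))
    let ?w = "w k y"
    have "1 / (2 * \<alpha> k) * (norm (?w - p))\<^sup>2 \<le> 1 / (2 * \<alpha> k) * (norm (?w - y))\<^sup>2
       + (f ?w s + \<delta> s / 2 * (norm (?w - y))\<^sup>2 - f y s) + (\<phi> ?w - \<phi> y) + \<alpha> k * (sqrt (q s))\<^sup>2 / 2"
      using wK[of k y] K'(2) by (intro bounds(2) upper[OF sP y w_eps[OF y]]) auto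
    then have "\<alpha> k / t * (1 / (2 * \<alpha> k) * (norm (?w - p))\<^sup>2) \<le> \<alpha> k / t * (1 / (2 * \<alpha> k) * (norm (?w - y))\<^sup>2
       + (f ?w s + \<delta> s / 2 * (norm (?w - y))\<^sup>2 - f y s) + (\<phi> ?w - \<phi> y) + \<alpha> k * (sqrt (q s))\<^sup>2 / 2)"
      using \<alpha>_pos[of k] t by (intro mult_left_mono) auto
    moreover have "\<alpha> k / t * (1 / (2 * \<alpha> k) * u) = u / (2 * t)" for u
      using \<alpha>_pos[of k] by simp
    ultimately have "(norm (?w - p))\<^sup>2 / (2 * t) \<le> (norm (?w - y))\<^sup>2 / (2 * t)
       + \<alpha> k / t * (f ?w s - f y s + \<phi> ?w - \<phi> y + \<delta> s / 2 * (norm (?w - y))\<^sup>2) + (\<alpha> k)\<^sup>2 * q s / (2 * t)"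
      using q(2)[of s] by (simp add: distrib_left algebra_simps power2_eq_square)
    then show "b + e p \<le> H k y s"
      using e_le[OF wK, of p k y] w_near[of k y] unfolding H_def by linarith
  qed
  have H_int: "integrable P (H k y)" for k y
    unfolding H_def using f_int \<delta>(1) q(1) by auto
  define c where "c k = (\<alpha> k)\<^sup>2 * (1 + 1 / t + (\<integral>s. q s \<partial>P) / (2 * t))" for k
  \<comment> \<open>In the mean the model inequality compares \<open>F (w k y)\<close> with \<open>F y\<close>, and near optimality of
    \<open>w k y\<close> turns their difference into the gap \<open>G y\<close>.\<close>
  have descent: "(\<integral>s. H k y s \<partial>P) \<le> (b + e y) - \<alpha> k / t * G y + c k" if y: "y \<in> K" for k y
  proof -
    let ?w = "w k y" and ?r = "(norm (w k y - y))\<^sup>2"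
    have "(\<integral>s. H k y s \<partial>P) = b + e y + \<eta> k + \<alpha> k / t * (mean_loss P f ?w - mean_loss P f y + \<phi> ?w - \<phi> y
        + \<Delta> / 2 * ?r) + (\<alpha> k)\<^sup>2 * (\<integral>s. q s \<partial>P) / (2 * t)"
      unfolding H_def \<Delta>_def mean_loss_def using f_int \<delta>(1) q(1) by (simp add: P.prob_space)
    also have "mean_loss P f ?w - mean_loss P f y + \<phi> ?w - \<phi> y + \<Delta> / 2 * ?r \<le> - G y + \<eta> k"
    proof -
      have "\<Delta> / 2 * ?r \<le> (1 / t) / 2 * ?r" using t\<Delta> by (intro mult_right_mono) auto
      then have "\<Delta> / 2 * ?r \<le> ?r / (2 * t)" by simp
      then show ?thesis using w_near[of k y] by (simp add: G_def F_def objective_def)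
    qed
    then have "\<alpha> k / t * (mean_loss P f ?w - mean_loss P f y + \<phi> ?w - \<phi> y + \<Delta> / 2 * ?r) \<le> \<alpha> k / t * (- G y + \<eta> k)"
      using \<alpha>_pos[of k] t by (intro mult_left_mono) auto
    also have "\<alpha> k / t * (- G y + \<eta> k) \<le> - (\<alpha> k / t * G y) + (\<alpha> k)\<^sup>2 / t"
    proof -
      have "\<alpha> k / t * \<eta> k \<le> \<alpha> k / t * \<alpha> k" using \<eta>(3) \<alpha>_pos[of k] t by (intro mult_left_mono) auto
      then show ?thesis by (simp add: algebra_simps diff_divide_distrib power2_eq_square)
    qed
    finally show ?thesis using \<eta>(4)[of k] unfolding c_def by (simp add: distrib_left)
  qed
  define A where "A k = {\<omega> \<in> space \<Omega>. \<forall>i\<le>k. norm (x i \<omega>) \<le> R}" for k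
  have AK: "x k \<omega> \<in> K" if "\<omega> \<in> A k" for k \<omega>
    using that iterate_in_X by (auto simp: A_def K_def)
  have A_past: "A k \<in> sets (past \<Omega> P S k)" for k
  proof -
    have "x i -` cball 0 R \<inter> space \<Omega> \<in> sets (past \<Omega> P S k)" if "i \<le> k" for i
      using measurable_sets[OF x_meas[of i], of "cball 0 R"] past_mono[OF that] by auto
    then have "(\<Inter>i\<in>{..k}. x i -` cball 0 R \<inter> space \<Omega>) \<in> sets (past \<Omega> P S k)"
      by (intro sets.finite_INT) auto
    also have "(\<Inter>i\<in>{..k}. x i -` cball 0 R \<inter> space \<Omega>) = A k" by (auto simp: A_def)
    finally show ?thesis .
  qed
  have on_X: "(\<lambda>\<omega>. h (x k \<omega>)) \<in> borel_measurable (past \<Omega> P S k)" if "continuous_on X h"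
    for h :: "'a \<Rightarrow> real" and k
  proof (rule measurable_compose[where N = "restrict_space borel X"])
    show "x k \<in> measurable (past \<Omega> P S k) (restrict_space borel X)"
      using x_meas iterate_in_X by (intro measurable_restrict_space2) auto
    show "h \<in> borel_measurable (restrict_space borel X)"
      using that by (rule borel_measurable_continuous_on_restrict)
  qed
  have H_meas: "(\<lambda>(\<omega>, s). H k (x k \<omega>) s) \<in> borel_measurable (past \<Omega> P S k \<Otimes>\<^sub>M P)" for k
  proof -
    have [measurable]: "x k \<in> borel_measurable (past \<Omega> P S k)" by (rule x_meas)
    have [measurable]: "e \<in> borel_measurable borel" "\<phi> \<in> borel_measurable borel"
      using e_cont continuous_\<phi> by (auto intro: borel_measurable_continuous_onI)
    have [measurable]: "\<delta> \<in> borel_measurable P" "q \<in> borel_measurable P" "f y \<in> borel_measurable P" for y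
      using \<delta> q f_int by auto
    have jm [measurable]: "(\<lambda>\<omega>. j k (x k \<omega>)) \<in> measurable (past \<Omega> P S k) (count_space UNIV)"
      unfolding j_def by measurable
    have [measurable]: "(\<lambda>\<omega>. w k (x k \<omega>)) \<in> borel_measurable (past \<Omega> P S k)"
      unfolding w_def by (rule measurable_compose[OF jm]) simp
    have [measurable]: "(\<lambda>(\<omega>, s). f (x k \<omega>) s) \<in> borel_measurable (past \<Omega> P S k \<Otimes>\<^sub>M P)"
      using iterate_in_X continuous_loss by (intro caratheodory_measurable_pair[where X = X]) auto
    have "(\<lambda>\<omega>s. (\<lambda>i \<omega>s. f (d i) (snd \<omega>s)) (j k (x k (fst \<omega>s))) \<omega>s) \<in> borel_measurable (past \<Omega> P S k \<Otimes>\<^sub>M P)"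
      by (rule measurable_compose_countable) measurable
    then have [measurable]: "(\<lambda>(\<omega>, s). f (w k (x k \<omega>)) s) \<in> borel_measurable (past \<Omega> P S k \<Otimes>\<^sub>M P)"
      by (simp add: w_def case_prod_beta')
    show ?thesis unfolding H_def by measurable
  qed
  have goodS: "AE \<omega> in \<Omega>. good (S k \<omega>)" for k
    by (rule AE_distr_eq[OF S_measurable S_distr AEgood])
  have "AE \<omega> in \<Omega>. (\<forall>k. \<omega> \<in> A k) \<longrightarrow> summable (\<lambda>k. \<alpha> k / t * G (x k \<omega>) * (1 + q (S k \<omega>)))"
  proof (rule expected_descent_imp_AE_summable[OF P S_indep S_distr,
        where V = "\<lambda>k \<omega>. b + e (x k \<omega>)" and H = "\<lambda>k \<omega>. H k (x k \<omega>)" and c = c and q = "\<lambda>s. 1 + q s"])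
    fix k
    show "A k \<in> sets (past \<Omega> P S k)" by (rule A_past)
    show "A (Suc k) \<subseteq> A k" by (auto simp: A_def)
    show "(\<lambda>\<omega>. b + e (x k \<omega>)) \<in> borel_measurable (past \<Omega> P S k)"
      using on_X[OF e_cont] by measurable
    show "(\<lambda>\<omega>. G (x k \<omega>)) \<in> borel_measurable (past \<Omega> P S k)"
      unfolding G_def by (intro on_X continuous_on_diff FX e_cont)
    show "(\<lambda>(\<omega>, s). H k (x k \<omega>) s) \<in> borel_measurable (past \<Omega> P S k \<Otimes>\<^sub>M P)" by (rule H_meas)
    show "AE \<omega> in \<Omega>. \<omega> \<in> A k \<longrightarrow> b + e (x (Suc k) \<omega>) \<le> H k (x k \<omega>) (S k \<omega>)"
      using goodS[of k]
    proof (eventually_elim, intro impI)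
      fix \<omega> assume "good (S k \<omega>)" "\<omega> \<in> A k"
      then show "b + e (x (Suc k) \<omega>) \<le> H k (x k \<omega>) (S k \<omega>)"
        by (intro step(2) AK iterate_is_arg_min) (auto simp: A_def)
    qed
    show "0 \<le> \<alpha> k / t" using \<alpha>_pos[of k] t by simp
    have "0 \<le> (\<integral>s. q s \<partial>P)" using q(2) by (intro integral_nonneg_AE) auto
    then show "0 \<le> c k" unfolding c_def using t by simp
    fix \<omega> assume \<omega>: "\<omega> \<in> A k"
    show "0 \<le> b + e (x k \<omega>)" using e_ge[of "x k \<omega>"] by simp
    show "0 \<le> G (x k \<omega>)" using AK[OF \<omega>] K' by (intro G0) auto
    show "integrable P (H k (x k \<omega>))" by (rule H_int)
    show "(\<integral>s. H k (x k \<omega>) s \<partial>P) \<le> b + e (x k \<omega>) - \<alpha> k / t * G (x k \<omega>) + c k"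
      by (rule descent[OF AK[OF \<omega>]])
    show "AE s in P. 0 \<le> H k (x k \<omega>) s"
      using AEgood
    proof eventually_elim
      fix s assume s: "good s"
      then have "s \<in> space P" by (simp add: good_def)
      moreover have "x k \<omega> \<in> X" using AK[OF \<omega>] K by auto
      ultimately obtain p where "is_arg_min (step_objective fm \<phi> (\<alpha> k) (x k \<omega>) s) (\<lambda>z. z \<in> X) p"
        using attained by blast
      from step(2)[OF s AK[OF \<omega>] this] e_ge[of p] show "0 \<le> H k (x k \<omega>) s" by linarith
    qed
  next
    fix \<omega> assume "\<omega> \<in> A 0"
    then have "x 0 \<omega> \<in> K'" using AK K' by auto
    from e_le[OF this, of "x 0 \<omega>"] b(2)[OF this] show "b + e (x 0 \<omega>) \<le> 2 * b" by simp
  next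
    show "summable c" unfolding c_def using \<alpha>_sum(2) by (rule summable_mult2)
    show "integrable P (\<lambda>s. 1 + q s)" using q(1) by auto
    show "0 \<le> 1 + q s" for s using q(2)[of s] by simp
  qed
  moreover have "AE \<omega> in \<Omega>. summable (\<lambda>k. (\<alpha> k)\<^sup>2 * q (S k \<omega>))"
    using S_measurable S_distr q \<alpha>_sum(2) by (intro AE_summable_sample) auto
  moreover have "AE \<omega> in \<Omega>. \<forall>k. good (S k \<omega>)" using goodS by (simp add: AE_all_countable)
  ultimately show ?thesis using AE_space
  proof eventually_elim
    fix \<omega> assume sum: "(\<forall>k. \<omega> \<in> A k) \<longrightarrow> summable (\<lambda>k. \<alpha> k / t * G (x k \<omega>) * (1 + q (S k \<omega>)))"
      and sq: "summable (\<lambda>k. (\<alpha> k)\<^sup>2 * q (S k \<omega>))" and gd: "\<forall>k. good (S k \<omega>)" and \<omega>: "\<omega> \<in> space \<Omega>"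
    show "(\<forall>k. norm (x k \<omega>) \<le> R) \<longrightarrow>
     (\<lambda>k. dist (x (Suc k) \<omega>) (x k \<omega>)) \<longlonglongrightarrow> 0 \<and>
     (\<forall>r z. strict_mono (r :: nat \<Rightarrow> nat) \<longrightarrow> (\<lambda>k. x (r k) \<omega>) \<longlonglongrightarrow> z \<longrightarrow> z \<in> stationary_set P X f \<phi>)"
    proof (intro impI conjI allI)
      assume bd: "\<forall>k. norm (x k \<omega>) \<le> R"
      then have inA: "\<omega> \<in> A k" for k using \<omega> by (simp add: A_def)
      then have xK: "x k \<omega> \<in> K" for k by (rule AK)
      have stp: "dist (x (Suc k) \<omega>) (x k \<omega>) \<le> 2 * \<alpha> k * sqrt (q (S k \<omega>))" for k
        using step(1)[OF gd[rule_format] xK iterate_is_arg_min[OF \<omega>]] by (simp add: dist_norm)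
      have "(\<lambda>k. 2 * sqrt ((\<alpha> k)\<^sup>2 * q (S k \<omega>))) \<longlonglongrightarrow> 2 * sqrt 0"
        by (intro tendsto_intros summable_LIMSEQ_zero[OF sq])
      then have "(\<lambda>k. 2 * \<alpha> k * sqrt (q (S k \<omega>))) \<longlonglongrightarrow> 0"
        using \<alpha>_pos by (simp add: real_sqrt_mult less_imp_le mult.assoc)
      then show step0: "(\<lambda>k. dist (x (Suc k) \<omega>) (x k \<omega>)) \<longlonglongrightarrow> 0"
        by (rule tendsto_sandwich[OF _ _ tendsto_const, rotated 2]) (auto simp: stp)
      have Gc: "continuous_on K G"
        unfolding G_def using FX K(2) by (intro continuous_on_diff e_cont) (rule continuous_on_subset)
      have "summable (\<lambda>k. t * (\<alpha> k / t * G (x k \<omega>) * (1 + q (S k \<omega>))))"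
        using sum inA by (intro summable_mult) auto
      then have sum': "summable (\<lambda>k. \<alpha> k * G (x k \<omega>) * (1 + q (S k \<omega>)))" using t by simp
      have G_lim: "(\<lambda>k. G (x k \<omega>)) \<longlonglongrightarrow> 0"
      proof (rule summable_gap_imp_tendsto_zero[where K = K and x = "\<lambda>k. x k \<omega>" and c = 2, OF _ _ xK _ \<alpha>_sum(1) _ sum' _ _ step0])
        show "uniformly_continuous_on K G" using Gc K(1) by (rule compact_uniformly_continuous)
        show "\<And>y. y \<in> K \<Longrightarrow> 0 \<le> G y" using G0 K' by auto
        show "\<And>k. 0 \<le> \<alpha> k" using \<alpha>_pos by (simp add: less_imp_le)
        show "\<And>k. 1 \<le> 1 + q (S k \<omega>)" using q(2) by simp
        fix k
        have "sqrt (q (S k \<omega>)) \<le> 1 + q (S k \<omega>)"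
          using q(2)[of "S k \<omega>"] by (intro real_le_lsqrt) (auto simp: power2_eq_square algebra_simps)
        then have "2 * \<alpha> k * sqrt (q (S k \<omega>)) \<le> 2 * \<alpha> k * (1 + q (S k \<omega>))"
          using \<alpha>_pos[of k] by (intro mult_left_mono) auto
        with stp[of k] show "dist (x (Suc k) \<omega>) (x k \<omega>) \<le> 2 * (\<alpha> k * (1 + q (S k \<omega>)))" by simp
      qed simp
      fix r :: "nat \<Rightarrow> nat" and z
      assume r: "strict_mono r" and lim: "(\<lambda>k. x (r k) \<omega>) \<longlonglongrightarrow> z"
      have zK: "z \<in> K"
        using closed_sequentially[OF compact_imp_closed[OF K(1)] xK lim] .
      have "(\<lambda>k. G (x (r k) \<omega>)) \<longlonglongrightarrow> G z"
        using xK zK by (intro continuous_on_tendsto_compose[OF Gc lim]) auto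
      moreover have "(\<lambda>k. G (x (r k) \<omega>)) \<longlonglongrightarrow> 0"
        using LIMSEQ_subseq_LIMSEQ[OF G_lim r] by (simp add: o_def)
      ultimately have "G z = 0" by (rule LIMSEQ_unique)
      show "z \<in> stationary_set P X f \<phi>"
      proof (rule envelope_fixed_point_stationary[where e = 1 and t = t])
        show "z \<in> X" using zK K by auto
        fix y assume y: "y \<in> X \<inter> cball z 1"
        have "norm y \<le> R + 1"
          using norm_triangle_ineq[of z "y - z"] y zK by (simp add: K_def dist_norm norm_minus_commute)
        then have "y \<in> K'" using y by (simp add: K'_def)
        from e_le[OF this, of z] \<open>G z = 0\<close>
        show "objective P f \<phi> z \<le> objective P f \<phi> y + (norm (y - z))\<^sup>2 / (2 * t)"
          by (simp add: G_def F_def)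
      qed simp
    qed
  qed
qed

end

theorem corollary3p21:
  fixes P :: "'s measure" and \<Omega> :: "'w measure"
    and X :: "'a::euclidean_space set"
    and f :: "'a \<Rightarrow> 's \<Rightarrow> real" and \<phi> :: "'a \<Rightarrow> real"
    and fm :: "'a \<Rightarrow> 'a \<Rightarrow> 's \<Rightarrow> ereal"
    and S :: "nat \<Rightarrow> 'w \<Rightarrow> 's" and x :: "nat \<Rightarrow> 'w \<Rightarrow> 'a"
    and \<alpha> :: "nat \<Rightarrow> real" and x0 :: 'a
  assumes P: "prob_space P"
    and \<Omega>: "prob_space \<Omega>"
    and S_indep: "prob_space.indep_vars \<Omega> (\<lambda>_. P) S UNIV"
    and S_distr: "\<And>k. distr \<Omega> P (S k) = P"
    and X: "X \<noteq> {}" "closed X" "convex X"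
    and \<phi>: "closed_convex_fun \<phi>"
    and f_int: "\<And>y. integrable P (\<lambda>s. f y s)"
    and fm_proper: "\<And>y z s. y \<in> X \<Longrightarrow> s \<in> space P \<Longrightarrow> fm y z s \<noteq> -\<infinity>"
    and fm_meas: "\<And>y z. y \<in> X \<Longrightarrow> (\<lambda>s. fm y z s) \<in> borel_measurable P"
    and C: "cond_C1 P X fm" "cond_C2 P X f fm" "cond_C3 P X f fm" "cond_C4 P X f fm"
    and L: "cond_L P X f"
    and W: "cond_W P X f"
    and \<alpha>_pos: "\<And>k. \<alpha> k > 0"
    and \<alpha>_sum: "\<not> summable \<alpha>" "summable (\<lambda>k. (\<alpha> k)\<^sup>2)"
    and attained: "\<And>k y s. y \<in> X \<Longrightarrow> s \<in> space P \<Longrightarrow>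
      \<exists>z. is_arg_min (step_objective fm \<phi> (\<alpha> k) y s) (\<lambda>z. z \<in> X) z"
    and argmin_meas: "\<And>k y. y \<in> X \<Longrightarrow>
      (\<lambda>s. arg_min (step_objective fm \<phi> (\<alpha> k) y s) (\<lambda>z. z \<in> X)) \<in> borel_measurable P"
    and x0: "x0 \<in> X" "\<And>\<omega>. \<omega> \<in> space \<Omega> \<Longrightarrow> x 0 \<omega> = x0"
    and x_step: "\<And>k \<omega>. \<omega> \<in> space \<Omega> \<Longrightarrow>
      x (Suc k) \<omega> = arg_min (step_objective fm \<phi> (\<alpha> k) (x k \<omega>) (S k \<omega>)) (\<lambda>z. z \<in> X)"
    and x_meas: "\<And>k. x k \<in> borel_measurable (past \<Omega> P S k)"
    and dense: "closure (- (objective P f \<phi> ` stationary_set P X f \<phi>)) = UNIV"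
    and bdd: "AE \<omega> in \<Omega>. bounded (range (\<lambda>k. x k \<omega>))"
    and coercive: "((\<lambda>y. if y \<in> X then ereal (objective P f \<phi> y) else \<infinity>) \<longlongrightarrow> \<infinity>) at_infinity"
  shows "AE \<omega> in \<Omega>.
    (\<forall>z. (\<exists>r :: nat \<Rightarrow> nat. strict_mono r \<and> (\<lambda>k. x (r k) \<omega>) \<longlonglongrightarrow> z) \<longrightarrow> z \<in> stationary_set P X f \<phi>) \<and>
    convergent (\<lambda>k. objective P f \<phi> (x k \<omega>))"
proof -
  interpret prob_space \<Omega> by (rule \<Omega>)
  interpret model_based_method \<Omega> P X f \<phi> fm S x \<alpha>
  proof (intro model_based_method.intro model_based_method_axioms.intro)
    show "convex_on UNIV \<phi>" using \<phi> by (simp add: closed_convex_fun_def)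
    show "x 0 \<omega> \<in> X" if "\<omega> \<in> space \<Omega>" for \<omega> using x0 that by simp
  qed (fact \<Omega> P S_indep S_distr X f_int fm_proper C L W \<alpha>_pos \<alpha>_sum attained x_step x_meas)+
  \<comment> \<open>countably many radii exhaust the bounded runs\<close>
  have "AE \<omega> in \<Omega>. \<forall>N::nat. (\<forall>k. norm (x k \<omega>) \<le> real N) \<longrightarrow>
     (\<lambda>k. dist (x (Suc k) \<omega>) (x k \<omega>)) \<longlonglongrightarrow> 0 \<and>
     (\<forall>r z. strict_mono (r :: nat \<Rightarrow> nat) \<longrightarrow> (\<lambda>k. x (r k) \<omega>) \<longlonglongrightarrow> z \<longrightarrow> z \<in> stationary_set P X f \<phi>)"
    unfolding AE_all_countable by (intro allI AE_bounded_run)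
  then show ?thesis using bdd AE_space
  proof eventually_elim
    fix \<omega> assume all: "\<forall>N::nat. (\<forall>k. norm (x k \<omega>) \<le> real N) \<longrightarrow>
     (\<lambda>k. dist (x (Suc k) \<omega>) (x k \<omega>)) \<longlonglongrightarrow> 0 \<and>
     (\<forall>r z. strict_mono (r :: nat \<Rightarrow> nat) \<longrightarrow> (\<lambda>k. x (r k) \<omega>) \<longlonglongrightarrow> z \<longrightarrow> z \<in> stationary_set P X f \<phi>)"
      and bd: "bounded (range (\<lambda>k. x k \<omega>))" and \<omega>: "\<omega> \<in> space \<Omega>"
    obtain B where B: "\<And>k. norm (x k \<omega>) \<le> B" using bd unfolding bounded_iff by auto
    obtain N :: nat where "B \<le> real N" using real_arch_simple by blast
    then have N: "norm (x k \<omega>) \<le> real N" for k using B[of k] by linarith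
    have step0: "(\<lambda>k. dist (x (Suc k) \<omega>) (x k \<omega>)) \<longlonglongrightarrow> 0"
      and cluster: "strict_mono (r :: nat \<Rightarrow> nat) \<Longrightarrow> (\<lambda>k. x (r k) \<omega>) \<longlonglongrightarrow> z \<Longrightarrow> z \<in> stationary_set P X f \<phi>"
      for r z
      using all N by blast+
    have "convergent (\<lambda>k. objective P f \<phi> (x k \<omega>))"
    proof (rule convergent_compose_of_codense_cluster_values[where K = "X \<inter> cball 0 (real N)",
          OF _ _ _ step0 cluster dense])
      show "compact (X \<inter> cball 0 (real N))" using \<open>closed X\<close> by (simp add: closed_Int_compact)
      show "x k \<omega> \<in> X \<inter> cball 0 (real N)" for k using iterate_in_X[OF \<omega>] N by simp
      show "continuous_on (X \<inter> cball 0 (real N)) (objective P f \<phi>)"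
        using continuous_objective by (rule continuous_on_subset) auto
    qed
    with cluster show "(\<forall>z. (\<exists>r :: nat \<Rightarrow> nat. strict_mono r \<and> (\<lambda>k. x (r k) \<omega>) \<longlonglongrightarrow> z) \<longrightarrow> z \<in> stationary_set P X f \<phi>) \<and>
      convergent (\<lambda>k. objective P f \<phi> (x k \<omega>))" by blast
  qed
qed

end
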